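(* Let $G$ be a torsion-free pseudo-fibered group, and for $f\in G$ let $\mathrm{Per}_f$ denote the set of all periodic points of $f$ on $S^1$. Then for any nontrivial elements $g,h\in G$, the sets $\mathrm{Per}_g$ and $\mathrm{Per}_h$ are either equal or disjoint.
   Context: A point $p\in S^1$ is periodic for $f$ if its orbit under $f$ is finite. $\mathrm{Homeo}^+(S^1)$ is the group of orientation-preserving homeomorphisms of the circle. Two pairs $(a,b)$, $(c,d)$ of distinct points of $S^1$ are linked if each connected component of $S^1\setminus\{a,b\}$ contains precisely one of $c,d$; otherwise they are unlinked. Let $\mathcal{M}=(S^1\times S^1\setminus\Delta)/((x,y)\sim(y,x))$, where $\Delta$ is the diagonal, be the space of unordered pairs of distinct points of $S^1$. A lamination of $S^1$ is a closed subset $\Lambda\subset\mathcal{M}$ whose elements (called leaves) are pairwise unlinked. The two points of a leaf are its endpoints. Two laminations have distinct endpoints if their sets of endpoints are disjoint. $\Lambda$ is dense if its set of endpoints is dense in $S^1$. For $G\le\mathrm{Homeo}^+(S^1)$, $\Lambda$ is $G$-invariant if the induced action of $G$ on $\mathcal{M}$ preserves $\Lambda$ set-wise. View $S^1=\partial_\infty\mathbb{H}^2$ as the boundary of the closed disk $\mathbb{D}=\mathbb{H}^2\cup\partial_\infty\mathbb{H}^2$, and identify a leaf with the geodesic of $\mathbb{H}^2$ joining its endpoints. A gap of $\Lambda$ is the closure in $\mathbb{D}$ of a connected component of $\mathbb{H}^2\setminus\Lambda$. $\Lambda$ is very full if each gap is a finite-sided ideal polygon; $\Lambda$ is loose if no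 two leaves share an endpoint unless they are edges of the same (necessarily unique) gap. A laminar group is a discrete subgroup of $\mathrm{Homeo}^+(S^1)$ admitting a dense invariant lamination. A pseudo-fibered group is a finitely generated laminar group $G$ which preserves a pair of very full loose laminations $\Lambda_1,\Lambda_2$ with distinct endpoints and such that each nontrivial element of $G$ has at most countably many fixed points in $S^1$. *)

theory Defs
  imports "HOL-Analysis.Analysis" "HOL-Algebra.Bij" "HOL-Algebra.Generated_Groups"
begin

section \<open>Homeomorphisms of the circle\<close>

abbreviation circle :: "complex set"
  where "circle \<equiv> sphere 0 1"

text \<open>Self-maps of the circle are extensional functions, multiplied in the library group
  \<^const>\<open>BijGroup\<close>. A homeomorphism preserves orientation iff it lifts, along the universal
  covering \<open>cis\<close>, to an increasing map of the line.\<close>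

definition orientation_preserving :: "(complex \<Rightarrow> complex) \<Rightarrow> bool"
  where "orientation_preserving f \<longleftrightarrow>
    (\<exists>F :: real \<Rightarrow> real. continuous_on UNIV F \<and> strict_mono F \<and> (\<forall>t. f (cis t) = cis (F t)))"

definition homeo_plus :: "(complex \<Rightarrow> complex) set"
  where "homeo_plus = {f \<in> Bij circle.
    homeomorphic_map (top_of_set circle) (top_of_set circle) f \<and> orientation_preserving f}"

text \<open>On maps of the compact circle the compact-open topology is the topology of the
  supremum metric, which is that of \<^const>\<open>cfunspace\<close>.\<close>

definition discrete_homeos :: "(complex \<Rightarrow> complex) set \<Rightarrow> bool"
  where "discrete_homeos G \<longleftrightarrow>
    subtopology (mtopology_of (cfunspace (top_of_set circle) euclidean_metric)) G
      = discrete_topology G"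

definition finitely_generated :: "(complex \<Rightarrow> complex) set \<Rightarrow> bool"
  where "finitely_generated G \<longleftrightarrow> (\<exists>S. finite S \<and> S \<subseteq> G \<and> G = generate (BijGroup circle) S)"

definition torsion_free :: "(complex \<Rightarrow> complex) set \<Rightarrow> bool"
  where "torsion_free G \<longleftrightarrow> (\<forall>g\<in>G. g \<noteq> \<one>\<^bsub>BijGroup circle\<^esub> \<longrightarrow>
    (\<forall>n::nat. n > 0 \<longrightarrow> g [^]\<^bsub>BijGroup circle\<^esub> n \<noteq> \<one>\<^bsub>BijGroup circle\<^esub>))"

definition Fix :: "(complex \<Rightarrow> complex) \<Rightarrow> complex set"
  where "Fix f = {p \<in> circle. f p = p}"

definition Per :: "(complex \<Rightarrow> complex) \<Rightarrow> complex set"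
  where "Per f = {p \<in> circle. finite {(f [^]\<^bsub>BijGroup circle\<^esub> n) p | n::int. True}}"


section \<open>Laminations\<close>

text \<open>An unordered pair of distinct points is a two-element set, so a leaf is the set of its
  endpoints, and \<open>\<Union>\<Lambda>\<close> is the set of endpoints of \<open>\<Lambda>\<close>.\<close>

definition pairs :: "complex set set"
  where "pairs = {{x, y} | x y. x \<in> circle \<and> y \<in> circle \<and> x \<noteq> y}"

definition linked :: "complex set \<Rightarrow> complex set \<Rightarrow> bool"
  where "linked l m \<longleftrightarrow> (\<forall>C \<in> components (circle - l). card (C \<inter> m) = 1)"

text \<open>The space of unordered pairs carries the quotient topology, so \<open>\<Lambda>\<close> is closed
  iff its preimage among the ordered pairs of distinct points is closed there.\<close>

definition lamination :: "complex set set \<Rightarrow> bool"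
  where "lamination \<Lambda> \<longleftrightarrow>
    \<Lambda> \<subseteq> pairs \<and>
    closedin (top_of_set (circle \<times> circle - Id)) {(x, y) \<in> circle \<times> circle - Id. {x, y} \<in> \<Lambda>} \<and>
    (\<forall>l\<in>\<Lambda>. \<forall>m\<in>\<Lambda>. \<not> linked l m)"

definition dense_lamination :: "complex set set \<Rightarrow> bool"
  where "dense_lamination \<Lambda> \<longleftrightarrow> circle \<subseteq> closure (\<Union>\<Lambda>)"

definition invariant :: "(complex \<Rightarrow> complex) set \<Rightarrow> complex set set \<Rightarrow> bool"
  where "invariant G \<Lambda> \<longleftrightarrow> (\<forall>g\<in>G. (\<lambda>l. g ` l) ` \<Lambda> = \<Lambda>)"

definition distinct_endpoints :: "complex set set \<Rightarrow> complex set set \<Rightarrow> bool"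
  where "distinct_endpoints \<Lambda>\<^sub>1 \<Lambda>\<^sub>2 \<longleftrightarrow> \<Union>\<Lambda>\<^sub>1 \<inter> \<Union>\<Lambda>\<^sub>2 = {}"


section \<open>Gaps\<close>

text \<open>The closed disk is the projective (Klein) model: the hyperbolic plane is the open unit
  disk, the geodesic with ideal endpoints \<open>a\<close> and \<open>b\<close> is the open chord between them, and the
  ideal polygon with a finite set \<open>V\<close> of ideal vertices is the convex hull of \<open>V\<close>.\<close>

abbreviation hyperbolic_plane :: "complex set"
  where "hyperbolic_plane \<equiv> ball 0 1"

definition geodesic :: "complex set \<Rightarrow> complex set"
  where "geodesic l = convex hull l \<inter> hyperbolic_plane"

text \<open>The closed disk is closed in the plane, so the closure there is the closure in the disk.\<close>

definition gaps :: "complex set set \<Rightarrow> complex set set"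
  where "gaps \<Lambda> = closure ` components (hyperbolic_plane - (\<Union>l\<in>\<Lambda>. geodesic l))"

definition ideal_polygon :: "complex set \<Rightarrow> bool"
  where "ideal_polygon P \<longleftrightarrow>
    (\<exists>V. finite V \<and> 3 \<le> card V \<and> V \<subseteq> circle \<and> P = convex hull V)"

definition very_full :: "complex set set \<Rightarrow> bool"
  where "very_full \<Lambda> \<longleftrightarrow> (\<forall>P \<in> gaps \<Lambda>. ideal_polygon P)"

text \<open>An edge of a gap, in the sense of \<^const>\<open>edge_of\<close>, is a one-dimensional face of that
  convex set.\<close>

definition loose :: "complex set set \<Rightarrow> bool"
  where "loose \<Lambda> \<longleftrightarrow> (\<forall>l\<in>\<Lambda>. \<forall>m\<in>\<Lambda>. l \<noteq> m \<longrightarrow> l \<inter> m \<noteq> {} \<longrightarrow>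
    (\<exists>P \<in> gaps \<Lambda>. (convex hull l) edge_of P \<and> (convex hull m) edge_of P))"


section \<open>Laminar and pseudo-fibered groups\<close>

definition laminar_group :: "(complex \<Rightarrow> complex) set \<Rightarrow> bool"
  where "laminar_group G \<longleftrightarrow>
    subgroup G (BijGroup circle) \<and> G \<subseteq> homeo_plus \<and> discrete_homeos G \<and>
    (\<exists>\<Lambda>. lamination \<Lambda> \<and> dense_lamination \<Lambda> \<and> invariant G \<Lambda>)"

definition pseudo_fibered_group :: "(complex \<Rightarrow> complex) set \<Rightarrow> bool"
  where "pseudo_fibered_group G \<longleftrightarrow>
    laminar_group G \<and> finitely_generated G \<and>
    (\<exists>\<Lambda>\<^sub>1 \<Lambda>\<^sub>2. lamination \<Lambda>\<^sub>1 \<and> lamination \<Lambda>\<^sub>2 \<and>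
      very_full \<Lambda>\<^sub>1 \<and> very_full \<Lambda>\<^sub>2 \<and> loose \<Lambda>\<^sub>1 \<and> loose \<Lambda>\<^sub>2 \<and>
      distinct_endpoints \<Lambda>\<^sub>1 \<Lambda>\<^sub>2 \<and> invariant G \<Lambda>\<^sub>1 \<and> invariant G \<Lambda>\<^sub>2) \<and>
    (\<forall>g\<in>G. g \<noteq> \<one>\<^bsub>BijGroup circle\<^esub> \<longrightarrow> countable (Fix g))"

end

theory Submission
  imports Defs "HOL-Real_Asymp.Real_Asymp"
begin

text \<open>Let \<open>H\<close> be the stabilizer of a point \<open>p\<close>, acting on the line by lifts that fix \<open>p\<close>. It
  suffices that \<open>H\<close> is abelian and that fixed points of nontrivial elements are isolated, since
  then commuting elements have the same fixed points; and \<open>Per g\<close> is the fixed point set of any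
  power of \<open>g\<close> that has a fixed point.

  A point that is not an endpoint of a very full lamination is surrounded by arbitrarily small
  leaves. Pushing such leaves by iterates of \<open>f \<in> H\<close> yields limit leaves. If \<open>f\<close> has at least three fixed
  points, then no two adjacent ones are endpoints of the same lamination, each fixed point is
  isolated, and its two neighbours are joined by a leaf of a lamination not ending at it. As
  loose laminations have at most two leaves at each point, \<open>H\<close> also fixes the other endpoint
  \<open>b\<close> of a leaf at \<open>p\<close>, and every nontrivial element has exactly one fixed point in \<open>(p, b)\<close>. If
  every nontrivial element of \<open>H\<close> has two fixed points, the same holds on the circle minus \<open>p\<close>.

  A group acting on an interval such that every nontrivial element has exactly one fixed point,
  attracting or repelling, is ordered by comparing germs at the right end. The order is
  bi-invariant and Archimedean, so the group is abelian by Hoelder's argument.\<close>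

text \<open>Every point is a non-endpoint of at least one of the two laminations, so small leaves
  around it exist in \<open>L\<close> or in \<open>L'\<close>; many statements are proved for one
  lamination and transferred by swapping the two. The recurring contradiction is a leaf that crosses
  its image. Applied to a short leaf around a fixed point with a free arc on each side, it forces
  the ends of the leaf to move in opposite directions, so such a fixed point attracts on both sides
  or repels on both sides. The main obstacle is accumulation of fixed points. Countability provides
  a point that moves; from there the bound of two leaves at each point excludes a first accumulation
  point. Lifts that fix a lift of p have monotone bounded orbits, so every pushed leaf has a limit.
  When there are three fixed points per period, the third one keeps the limit from degenerating to a
  point. Torsion-freeness keeps the powers nontrivial when periodic points are replaced by fixed
  points.\<close>

text \<open>The plain notation for inverse functions is taken by the inverse of group elements.\<close>

abbreviation inv_map :: "(real \<Rightarrow> real) \<Rightarrow> real \<Rightarrow> real"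
  where "inv_map F \<equiv> inv_into UNIV F"


section \<open>Increasing bijections of the line and convergence of their orbits\<close>

lemma increasing_surj_continuous:
  fixes F :: "real \<Rightarrow> real"
  assumes "strict_mono F" "surj F"
  shows "continuous_on UNIV F"
  using assms by (intro continuous_onI_mono) (auto simp: strict_mono_less_eq)

lemma strict_mono_inv_real:
  fixes F :: "real \<Rightarrow> real"
  assumes "strict_mono F" "surj F"
  shows "strict_mono (inv_map F)" "surj (inv_map F)"
proof -
  have "inj F" using assms strict_mono_imp_inj_on by blast
  then show "surj (inv_map F)" by (simp add: inj_imp_surj_inv)
  show "strict_mono (inv_map F)"
    by (metis assms strict_mono_inv_on_range)
qed

lemma iterate_strict_mono:
  fixes F :: "real \<Rightarrow> real"
  assumes "strict_mono F" shows "strict_mono (F ^^ n)"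
  using assms by (induction n) (auto simp: strict_mono_def)

text \<open>The orbit increases below the fixed point \<open>b\<close>, and its limit is fixed by
  continuity. The last, strict bound lets an orbit accumulate at \<open>y\<close> without reaching
  it, which is what contradicts isolation later.\<close>

lemma iterate_converges_up:
  fixes F :: "real \<Rightarrow> real"
  assumes F: "strict_mono F" "surj F" and fixed: "F b = b" and x: "x \<le> b" "x < F x"
  obtains y where "(\<lambda>n. (F ^^ n) x) \<longlonglongrightarrow> y" "F y = y" "x < y" "y \<le> b"
    "\<And>n. (F ^^ n) x < y"
proof -
  let ?s = "\<lambda>n. (F ^^ n) x"
  have step: "?s n < ?s (Suc n)" for n
    using strict_monoD[OF iterate_strict_mono[OF F(1)] x(2)] by (simp add: funpow_swap1)
  then have inc: "strict_mono ?s" by (simp add: strict_mono_Suc_iff)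
  have le: "?s n \<le> b" for n
  proof (induction n)
    case (Suc n) then show ?case using F(1) fixed by (metis comp_apply funpow.simps(2) strict_mono_less_eq)
  qed (use x in simp)
  obtain y where y: "?s \<longlonglongrightarrow> y" "\<And>n. ?s n \<le> y"
    using incseq_convergent[OF strict_mono_mono[OF inc], of b] le by blast
  have "(\<lambda>n. F (?s n)) \<longlonglongrightarrow> F y"
    using increasing_surj_continuous[OF F] y(1)
    by (rule continuous_on_tendsto_compose) auto
  moreover have "(\<lambda>n. ?s (Suc n)) \<longlonglongrightarrow> y" using y(1) by (rule LIMSEQ_Suc)
  ultimately have "F y = y" using LIMSEQ_unique by fastforce
  have lt: "?s n < y" for n using step[of n] y(2)[of "Suc n"] by linarith
  have "x < y" using lt[of 0] by simp
  have "y \<le> b" using LIMSEQ_le_const2[OF y(1)] le by blast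
  show ?thesis by (rule that) fact+
qed

lemma iterate_converges_down:
  fixes F :: "real \<Rightarrow> real"
  assumes F: "strict_mono F" "surj F" and fixed: "F a = a" and x: "a \<le> x" "F x < x"
  obtains y where "(\<lambda>n. (F ^^ n) x) \<longlonglongrightarrow> y" "F y = y" "y < x" "a \<le> y"
    "\<And>n. y < (F ^^ n) x"
proof -
  \<comment> \<open>Conjugation by negation turns the decreasing orbit of \<open>F\<close> into an
    increasing orbit of \<open>G\<close>.\<close>
  define G where "G = (\<lambda>x. - F (- x))"
  have G: "strict_mono G"
    using F(1) by (simp add: strict_mono_def G_def)
  have "surj G"
  proof (rule surjI)
    show "G (- inv_map F (- w)) = w" for w by (simp add: G_def surj_f_inv_f[OF F(2)])
  qed
  have it: "(G ^^ n) z = - (F ^^ n) (- z)" for n z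
    by (induction n) (auto simp: G_def)
  obtain y where y: "(\<lambda>n. (G ^^ n) (-x)) \<longlonglongrightarrow> y" "G y = y" "-x < y" "y \<le> -a" "\<And>n. (G ^^ n) (-x) < y"
    using iterate_converges_up[OF G \<open>surj G\<close>, of "-a" "-x"] fixed x by (auto simp: G_def)
  show ?thesis
  proof (rule that[of "-y"])
    show "(\<lambda>n. (F ^^ n) x) \<longlonglongrightarrow> - y" using tendsto_minus[OF y(1)] by (simp add: it)
    show "- y < (F ^^ n) x" for n using y(5)[of n] by (simp add: it)
  qed (use y in \<open>auto simp: G_def\<close>)
qed

section \<open>Groups acting on an interval with one fixed point each\<close>

text \<open>\<open>one_fixed\<close> says that the single fixed point in (a, b) is repelling or
  attracting. Since \<open>f \<noteq> id\<close> refers to the whole line, the action on (a, b) is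
  faithful, and two elements with the same germ at \<open>b\<close> are equal.\<close>

locale one_fixed_point_action =
  fixes S :: "(real \<Rightarrow> real) set" and a b :: real
  assumes ab: "a < b"
    and smono: "f \<in> S \<Longrightarrow> strict_mono f" and surj: "f \<in> S \<Longrightarrow> surj f"
    and ends: "f \<in> S \<Longrightarrow> f a = a" "f \<in> S \<Longrightarrow> f b = b"
    and comp: "f \<in> S \<Longrightarrow> g \<in> S \<Longrightarrow> f \<circ> g \<in> S" and inv_closed: "f \<in> S \<Longrightarrow> inv_map f \<in> S"
    and one_fixed: "f \<in> S \<Longrightarrow> f \<noteq> id \<Longrightarrow> \<exists>e. a < e \<and> e < b \<and>
       ((\<forall>x. a < x \<and> x < e \<longrightarrow> f x < x) \<and> (\<forall>x. e < x \<and> x < b \<longrightarrow> x < f x) \<or>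
        (\<forall>x. a < x \<and> x < e \<longrightarrow> x < f x) \<and> (\<forall>x. e < x \<and> x < b \<longrightarrow> f x < x))"
begin

definition ev :: "(real \<Rightarrow> bool) \<Rightarrow> bool"
  where "ev Q \<longleftrightarrow> eventually Q (at_left b)"

lemma evI: "e < b \<Longrightarrow> (\<And>x. e < x \<Longrightarrow> x < b \<Longrightarrow> Q x) \<Longrightarrow> ev Q"
  unfolding ev_def eventually_at_left_field by blast

lemma ev_mono: "ev Q \<Longrightarrow> (\<And>x. Q x \<Longrightarrow> R x) \<Longrightarrow> ev R"
  unfolding ev_def by (rule eventually_mono)

lemma ev_conj: "ev Q \<Longrightarrow> ev R \<Longrightarrow> ev (\<lambda>x. Q x \<and> R x)"
  unfolding ev_def by (rule eventually_conj)

lemma ev_False: "\<not> ev (\<lambda>x. False)"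
  unfolding ev_def by simp

lemma inv_left: "f \<in> S \<Longrightarrow> inv_map f (f x) = x"
  by (meson smono inv_f_f strict_mono_imp_inj_on)

lemma inv_right: "f \<in> S \<Longrightarrow> f (inv_map f x) = x"
  by (simp add: surj surj_f_inv_f)

lemma less_iff: "f \<in> S \<Longrightarrow> f x < f y \<longleftrightarrow> x < y"
  by (simp add: smono strict_mono_less)

text \<open>Elements of \<open>S\<close> are increasing and fix \<open>b\<close>, so they map left
  neighbourhoods of \<open>b\<close> to left neighbourhoods of \<open>b\<close>. This makes the germ
  order right-invariant.\<close>

lemma ev_comp:
  assumes "f \<in> S" "ev Q" shows "ev (\<lambda>x. Q (f x))"
proof -
  obtain e where e: "e < b" "\<And>x. e < x \<Longrightarrow> x < b \<Longrightarrow> Q x"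
    using assms(2) unfolding ev_def eventually_at_left_field by blast
  show ?thesis
  proof (rule evI[where e = "inv_map f e"])
    have "f (inv_map f e) < f b" using e(1) ends(2)[OF assms(1)] inv_right[OF assms(1)] by simp
    then show "inv_map f e < b" using less_iff[OF assms(1)] by blast
    show "Q (f x)" if "inv_map f e < x" "x < b" for x
    proof (rule e(2))
      show "e < f x" using that(1) less_iff[OF assms(1), of "inv_map f e" x] inv_right[OF assms(1)] by simp
      show "f x < b" using that(2) less_iff[OF assms(1), of x b] ends(2)[OF assms(1)] by simp
    qed
  qed
qed

lemma id_in: "f \<in> S \<Longrightarrow> id \<in> S"
  using comp[OF inv_closed] by (metis inv_o_cancel smono strict_mono_imp_inj_on)

lemma iter_in: "f \<in> S \<Longrightarrow> f ^^ n \<in> S"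
proof (induction n)
  case 0 then show ?case using id_in by (simp add: id_def)
next
  case (Suc n) then show ?case using comp by (metis funpow.simps(2))
qed

definition lt :: "(real \<Rightarrow> real) \<Rightarrow> (real \<Rightarrow> real) \<Rightarrow> bool"
  where "lt f g \<longleftrightarrow> ev (\<lambda>x. f x < g x)"

text \<open>Unless it is the identity, the quotient of \<open>g\<close> by \<open>f\<close> moves
  all points beyond its fixed point in one direction, and this decides the comparison near
  \<open>b\<close>.\<close>

lemma lt_trichotomy:
  assumes "f \<in> S" "g \<in> S" shows "lt f g \<or> f = g \<or> lt g f"
proof (cases "inv_map f \<circ> g = id")
  case True
  then have "f ((inv_map f \<circ> g) x) = f x" for x by simp
  then show ?thesis by (auto simp: inv_right[OF assms(1)] fun_eq_iff)
next
  case False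
  have "inv_map f \<circ> g \<in> S" using assms comp inv_closed by blast
  from one_fixed[OF this False] obtain e where e: "e < b"
    "(\<forall>x. e < x \<and> x < b \<longrightarrow> x < (inv_map f \<circ> g) x) \<or> (\<forall>x. e < x \<and> x < b \<longrightarrow> (inv_map f \<circ> g) x < x)"
    by blast
  have "x < (inv_map f \<circ> g) x \<longleftrightarrow> f x < g x" "(inv_map f \<circ> g) x < x \<longleftrightarrow> g x < f x" for x
    using less_iff[OF assms(1), of x "(inv_map f \<circ> g) x"] less_iff[OF assms(1), of "(inv_map f \<circ> g) x" x]
    by (simp_all add: inv_right[OF assms(1)])
  then show ?thesis using e(2) evI[OF e(1)] unfolding lt_def by presburger
qed

lemma lt_irrefl: "\<not> lt f f"
  unfolding lt_def using ev_False by simp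

lemma lt_trans: "lt f g \<Longrightarrow> lt g h \<Longrightarrow> lt f h"
  unfolding lt_def by (drule (1) ev_conj, erule ev_mono) auto

lemma lt_left: "k \<in> S \<Longrightarrow> lt f g \<Longrightarrow> lt (k \<circ> f) (k \<circ> g)"
  unfolding lt_def by (simp add: less_iff)

lemma lt_right: "k \<in> S \<Longrightarrow> lt f g \<Longrightarrow> lt (f \<circ> k) (g \<circ> k)"
  unfolding lt_def using ev_comp[of k "\<lambda>x. f x < g x"] by simp

lemma lt_comp: "f \<in> S \<Longrightarrow> k \<in> S \<Longrightarrow> lt f g \<Longrightarrow> lt h k \<Longrightarrow> lt (f \<circ> h) (g \<circ> k)"
  by (blast intro: lt_left lt_right lt_trans)

lemma lt_left_cancel: "k \<in> S \<Longrightarrow> lt (k \<circ> f) (k \<circ> g) \<Longrightarrow> lt f g"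
  unfolding lt_def by (simp add: less_iff)

lemma lt_right_cancel:
  assumes "k \<in> S" "lt (f \<circ> k) (g \<circ> k)" shows "lt f g"
  using lt_right[OF inv_closed[OF assms(1)] assms(2)] inv_right[OF assms(1)]
  by (simp add: comp_def)

text \<open>If \<open>c\<close> were infinitesimal compared with \<open>g\<close>, then for large \<open>n\<close> the map \<open>g\<inverse> \<circ> c\<^sup>n\<close> would
  contract at both ends of the interval but expand around the fixed point of \<open>c\<close>.\<close>

lemma archimedean:
  assumes c: "c \<in> S" "lt id c" and g: "g \<in> S"
  shows "\<exists>n. \<not> lt (c ^^ n) g"
proof (rule ccontr)
  assume "\<not> ?thesis"
  then have all: "lt (c ^^ n) g" for n by blast
  have "c \<noteq> id" using c(2) lt_irrefl by auto
  from one_fixed[OF c(1) this] obtain e where e: "a < e" "e < b" and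
    alt: "(\<forall>x. a < x \<and> x < e \<longrightarrow> c x < x) \<and> (\<forall>x. e < x \<and> x < b \<longrightarrow> x < c x) \<or>
     (\<forall>x. e < x \<and> x < b \<longrightarrow> c x < x)" by blast
  \<comment> \<open>Positivity near \<open>b\<close> excludes the attracting type, so
    \<open>c\<close> pushes points away from \<open>e\<close> towards both ends of the
    interval.\<close>
  have "\<not> (\<forall>x. e < x \<and> x < b \<longrightarrow> c x < x)"
  proof
    assume "\<forall>x. e < x \<and> x < b \<longrightarrow> c x < x"
    then have "lt c id" unfolding lt_def by (intro evI[OF e(2)]) auto
    then show False using c(2) lt_trans lt_irrefl by blast
  qed
  with alt have cx: "\<And>x. a < x \<Longrightarrow> x < e \<Longrightarrow> c x < x" "\<And>x. e < x \<Longrightarrow> x < b \<Longrightarrow> x < c x"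
    by blast+
  \<comment> \<open>One sample point on each side of \<open>e\<close>. Powers of \<open>c\<close>
    carry \<open>x1\<close> beyond \<open>g x1\<close> towards \<open>b\<close>, and
    \<open>x0\<close> beyond \<open>g x0\<close> towards \<open>a\<close>.\<close>
  define x0 where "x0 = (a + e) / 2"
  define x1 where "x1 = (e + b) / 2"
  have x: "a < x0" "x0 < e" "e < x1" "x1 < b" using e by (auto simp: x0_def x1_def)
  have "eventually (\<lambda>n. g x1 < (c ^^ n) x1) sequentially"
  proof -
    obtain y where y: "(\<lambda>n. (c ^^ n) x1) \<longlonglongrightarrow> y" "c y = y" "x1 < y" "y \<le> b"
      using iterate_converges_up[OF smono[OF c(1)] surj[OF c(1)] ends(2)[OF c(1)], of x1] x cx(2)[of x1]
      by (metis less_imp_le)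
    then have "y = b" using cx(2)[of y] x by fastforce
    moreover have "g x1 < b" using g ends(2) less_iff x(4) by metis
    ultimately show ?thesis using order_tendstoD(1)[OF y(1)] by simp
  qed
  moreover have "eventually (\<lambda>n. (c ^^ n) x0 < g x0) sequentially"
  proof -
    obtain y where y: "(\<lambda>n. (c ^^ n) x0) \<longlonglongrightarrow> y" "c y = y" "y < x0" "a \<le> y"
      using iterate_converges_down[OF smono[OF c(1)] surj[OF c(1)] ends(1)[OF c(1)], of x0] x cx(1)[of x0]
      by (metis less_imp_le)
    then have "y = a" using cx(1)[of y] x by fastforce
    moreover have "a < g x0" using g ends(1) less_iff x(1) by metis
    ultimately show ?thesis using order_tendstoD(2)[OF y(1)] by simp
  qed
  ultimately have "eventually (\<lambda>n. g x1 < (c ^^ n) x1 \<and> (c ^^ n) x0 < g x0) sequentially"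
    by (rule eventually_conj)
  then obtain n where n: "g x1 < (c ^^ n) x1" "(c ^^ n) x0 < g x0"
    unfolding eventually_sequentially by blast
  let ?k = "inv_map g \<circ> c ^^ n"
  have kS: "?k \<in> S" using c g comp inv_closed iter_in by blast
  have k: "x1 < ?k x1" "?k x0 < x0" using n inv_right[OF g] g by (metis comp_apply less_iff)+
  \<comment> \<open>Below the identity near \<open>b\<close>, the map \<open>?k\<close> must be of
    attracting type: up before \<open>e'\<close>, down after it. The two moves in \<open>k\<close>
    then give \<open>x1 \<le> e'\<close> and \<open>e' \<le> x0\<close>.\<close>
  have ltk: "lt ?k id"
    using lt_left[OF inv_closed[OF g] all] inv_left[OF g] by (simp add: lt_def)
  have "?k \<noteq> id" using k(1) by (metis id_apply less_irrefl)
  from one_fixed[OF kS this] obtain e' where e': "a < e'" "e' < b" and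
    alt': "(\<forall>x. e' < x \<and> x < b \<longrightarrow> x < ?k x) \<or>
     (\<forall>x. a < x \<and> x < e' \<longrightarrow> x < ?k x) \<and> (\<forall>x. e' < x \<and> x < b \<longrightarrow> ?k x < x)" by blast
  have "\<not> (\<forall>x. e' < x \<and> x < b \<longrightarrow> x < ?k x)"
  proof
    assume "\<forall>x. e' < x \<and> x < b \<longrightarrow> x < ?k x"
    then have "lt id ?k" unfolding lt_def by (intro evI[OF e'(2)]) auto
    then show False using ltk lt_trans lt_irrefl by blast
  qed
  with alt' have kx: "\<And>x. a < x \<Longrightarrow> x < e' \<Longrightarrow> x < ?k x" "\<And>x. e' < x \<Longrightarrow> x < b \<Longrightarrow> ?k x < x"
    by blast+
  have "x1 \<le> e'" using kx(2)[of x1] k(1) x by linarith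
  moreover have "e' \<le> x0" using kx(1)[of x0] k(2) x by linarith
  ultimately show False using x by linarith
qed

text \<open>This is the integer part of \<open>g\<close> in units of \<open>d\<close>. By trichotomy
  the first conclusion means that \<open>d ^^ m\<close> is equal to \<open>g\<close> or below
  it.\<close>

lemma power_sandwich:
  assumes d: "d \<in> S" "lt id d" and g: "g \<in> S" "lt id g"
  obtains m where "\<not> lt g (d ^^ m)" "lt g (d ^^ Suc m) "
proof -
  have "\<exists>n. lt g (d ^^ n)"
  proof -
    obtain n where "\<not> lt (d ^^ n) g" using archimedean[OF d g(1)] by blast
    then have "d ^^ n = g \<or> lt g (d ^^ n)" using lt_trichotomy iter_in d g by blast
    moreover have "lt (d ^^ n) (d ^^ Suc n)"
      using lt_right[OF iter_in[OF d(1)] d(2), of n] by simp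
    ultimately show ?thesis using lt_trans by blast
  qed
  then obtain n where n: "lt g (d ^^ n)" "\<And>k. k < n \<Longrightarrow> \<not> lt g (d ^^ k)"
    using exists_least_iff[of "\<lambda>n. lt g (d ^^ n)"] by blast
  have "n \<noteq> 0"
    using n(1) g(2) lt_trans lt_irrefl by (metis funpow_0 id_def funpow.simps(1))
  then obtain m where "n = Suc m" using not0_implies_Suc by blast
  then show ?thesis using n that by blast
qed

lemma lt_not_sym: "lt f g \<Longrightarrow> \<not> lt g f"
  using lt_trans lt_irrefl by blast

text \<open>Hoelder's argument: integer parts of g and h in units of d determine both gh and hg up
  to a factor less than d^2, so their positive quotient c is below d^2 for every positive d. This
  forces c to be the least positive element, and then everything positive is a power of c and
  commutes.\<close>

lemma noncommuting_positive_False: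
  assumes g: "g \<in> S" "lt id g" and h: "h \<in> S" "lt id h" and gh: "lt (h \<circ> g) (g \<circ> h)"
  shows False
proof -
  define c where "c = (g \<circ> h) \<circ> inv_map (h \<circ> g)"
  have hgS: "h \<circ> g \<in> S" and ghS: "g \<circ> h \<in> S" using g h comp by auto
  have cS: "c \<in> S" unfolding c_def using hgS ghS comp inv_closed by blast
  have cgh: "c \<circ> (h \<circ> g) = g \<circ> h"
    unfolding c_def using inv_left[OF hgS] by (auto simp: fun_eq_iff)
  have cpos: "lt id c"
    using lt_right_cancel[OF hgS, of id c] gh cgh by simp
  \<comment> \<open>From d^m <= g < d^(m+1) and d^n <= h < d^(n+1) follow d^(m+n) <= hg and c(hg) =
    gh < d^(m+n+2), hence c < d^2.\<close>
  have no_sqrt: "\<not> (\<exists>d \<in> S. lt id d \<and> \<not> lt c (d \<circ> d))"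
  proof
    assume "\<exists>d \<in> S. lt id d \<and> \<not> lt c (d \<circ> d)"
    then obtain d where d: "d \<in> S" "lt id d" "\<not> lt c (d \<circ> d)" by blast
    obtain m where m: "\<not> lt g (d ^^ m)" "lt g (d ^^ Suc m)" using power_sandwich[OF d(1,2) g] .
    obtain n where n: "\<not> lt h (d ^^ n)" "lt h (d ^^ Suc n)" using power_sandwich[OF d(1,2) h] .
    have dS: "d ^^ k \<in> S" for k using iter_in d by blast
    have "lt (g \<circ> h) (d ^^ Suc m \<circ> d ^^ Suc n)"
      using lt_comp g(1) dS m(2) n(2) by blast
    moreover have "d ^^ Suc m \<circ> d ^^ Suc n = (d \<circ> d) \<circ> (d ^^ (m + n))"
    proof -
      have "d ^^ Suc m \<circ> d ^^ Suc n = d ^^ (Suc m + Suc n)" by (simp only: funpow_add)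
      also have "\<dots> = d ^^ Suc (Suc (m + n))" by simp
      finally show ?thesis by (simp only: funpow.simps(2) o_assoc)
    qed
    ultimately have up: "lt (c \<circ> (h \<circ> g)) ((d \<circ> d) \<circ> (d ^^ (m + n)))"
      unfolding cgh by simp
    have "\<not> lt (h \<circ> g) (d ^^ (m + n))"
    proof
      assume "lt (h \<circ> g) (d ^^ (m + n))"
      then have l: "lt (h \<circ> g) (d ^^ n \<circ> d ^^ m)" by (simp only: add.commute[of m n] funpow_add)
      consider "d ^^ n = h" | "lt (d ^^ n) h" using lt_trichotomy[OF h(1) dS] n(1) by blast
      then have "\<not> lt (h \<circ> g) (d ^^ n \<circ> g)"
      proof cases
        case 1 then show ?thesis using lt_irrefl by simp
      next
        case 2 then show ?thesis using lt_right[OF g(1)] lt_not_sym by blast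
      qed
      moreover have "d ^^ m = g \<or> lt (d ^^ n \<circ> d ^^ m) (d ^^ n \<circ> g)"
        using lt_trichotomy[OF g(1) dS[of m]] m(1) lt_left[OF dS] by blast
      ultimately show False using l lt_trans[OF l] by auto
    qed
    then have "d ^^ (m + n) = h \<circ> g \<or> lt (d ^^ (m + n)) (h \<circ> g)"
      using lt_trichotomy[OF hgS dS[of "m + n"]] by auto
    then have "lt (c \<circ> d ^^ (m + n)) ((d \<circ> d) \<circ> d ^^ (m + n))"
      using up lt_trans[OF lt_left[OF cS] up] by auto
    then have "lt c (d \<circ> d)" by (rule lt_right_cancel[OF dS])
    then show False using d(3) by blast
  qed
  \<comment> \<open>Suppose id < x < c and write c = yx. Both squares exceed c by
    \<open>no_sqrt\<close>. So yx < yy, which gives x < y, and then xx < yx = c, a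
    contradiction.\<close>
  have least: "\<not> lt x c" if x: "x \<in> S" "lt id x" for x
  proof
    assume xc: "lt x c"
    have xx: "lt c (x \<circ> x)" using no_sqrt x by blast
    define y where "y = c \<circ> inv_map x"
    have yS: "y \<in> S" using y_def cS x(1) comp inv_closed by blast
    have yx: "y \<circ> x = c" using inv_left[OF x(1)] by (auto simp: y_def fun_eq_iff)
    have "lt id y" using lt_right_cancel[OF x(1), of id y] xc yx by simp
    then have "lt c (y \<circ> y)" using no_sqrt yS by blast
    then have "lt (y \<circ> x) (y \<circ> y)" using yx by simp
    then have "lt x y" by (rule lt_left_cancel[OF yS])
    then have "lt (x \<circ> x) (y \<circ> x)" by (rule lt_right[OF x(1)])
    then show False using xx lt_not_sym unfolding yx by blast
  qed
  \<comment> \<open>Division with remainder by \<open>c\<close>: the remainder \<open>y\<close> is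
    not negative and is below the least positive element, so it is the identity.\<close>
  have pow: "\<exists>m. f = c ^^ m" if f: "f \<in> S" "lt id f" for f
  proof -
    obtain m where m: "\<not> lt f (c ^^ m)" "lt f (c ^^ Suc m)" using power_sandwich[OF cS cpos f] .
    have cm: "c ^^ m \<in> S" using iter_in cS by blast
    define y where "y = f \<circ> inv_map (c ^^ m)"
    have yS: "y \<in> S" using y_def cm f(1) comp inv_closed by blast
    have yx: "y \<circ> c ^^ m = f" using inv_left[OF cm] by (auto simp: y_def fun_eq_iff)
    have "lt (y \<circ> c ^^ m) (c \<circ> c ^^ m)" using m(2) yx by simp
    then have "lt y c" by (rule lt_right_cancel[OF cm])
    then have "\<not> lt id y" using least yS by blast
    moreover have "\<not> lt y id"
    proof
      assume "lt y id"
      then have "lt f (c ^^ m)" using lt_right[OF cm, of y id] yx by simp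
      then show False using m(1) by blast
    qed
    ultimately have "y = id" using lt_trichotomy[OF yS id_in[OF yS]] by blast
    then show ?thesis using yx by auto
  qed
  obtain m where m: "g = c ^^ m" using pow[OF g] by blast
  obtain n where n: "h = c ^^ n" using pow[OF h] by blast
  have "h \<circ> g = g \<circ> h" unfolding m n by (simp only: add.commute[of m n] funpow_add[symmetric])
  then show False using gh lt_irrefl by metis
qed

theorem commute:
  assumes "g \<in> S" "h \<in> S"
  shows "g \<circ> h = h \<circ> g"
proof -
  have pos: "g \<circ> h = h \<circ> g" if "g \<in> S" "h \<in> S" "lt id g" "lt id h" for g h
    using lt_trichotomy[of "g \<circ> h" "h \<circ> g"] noncommuting_positive_False that comp by blast
  have neg: "lt id (inv_map f)" if "f \<in> S" "f \<noteq> id" "\<not> lt id f" for f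
  proof -
    have "lt f id" using that lt_trichotomy id_in by blast
    then have "lt (inv_map f \<circ> f) (inv_map f \<circ> id)" using lt_left inv_closed that by blast
    then show ?thesis by (simp add: inv_left[OF that(1)] lt_def)
  qed
  have flip: "g \<circ> h = h \<circ> g" if "g \<in> S" "h \<in> S" "inv_map g \<circ> h = h \<circ> inv_map g" for g h
  proof
    fix x
    have "inv_map g (h (g x)) = h x"
      using that by (metis comp_apply inv_left)
    then show "(g \<circ> h) x = (h \<circ> g) x" by (metis comp_apply inv_right that(1))
  qed
  have half: "g \<circ> h = h \<circ> g" if "g \<in> S" "h \<in> S" "lt id h" for g h
  proof -
    consider "g = id" | "lt id g" | "lt id (inv_map g)" using neg[OF \<open>g \<in> S\<close>] by auto
    then show ?thesis
    proof cases
      case 2 then show ?thesis using pos that by blast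
    next
      case 3
      then have "inv_map g \<circ> h = h \<circ> inv_map g" using pos[OF inv_closed] that by blast
      then show ?thesis using flip that by blast
    qed simp
  qed
  show ?thesis
  proof -
    consider "h = id" | "lt id h" | "lt id (inv_map h)" using neg[OF assms(2)] by auto
    then show ?thesis
    proof cases
      case 3
      then have "g \<circ> inv_map h = inv_map h \<circ> g" using half assms inv_closed by blast
      then have "inv_map h \<circ> g = g \<circ> inv_map h" by (rule sym)
      then show ?thesis using flip[OF assms(2,1)] by metis
    next
      case 2 then show ?thesis using half assms by blast
    qed simp
  qed
qed

end

section \<open>Laminations lifted to the line\<close>

text \<open>A bounded component of the complement of the fixed point set, given by its two
  ends.\<close>

definition free_arc :: "(real \<Rightarrow> real) \<Rightarrow> real \<Rightarrow> real \<Rightarrow> bool"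
  where "free_arc F u v \<longleftrightarrow> u < v \<and> F u = u \<and> F v = v \<and> (\<forall>x. u < x \<and> x < v \<longrightarrow> F x \<noteq> x)"

text \<open>Three distinct fixed points on the circle of length \<open>P\<close>; the bound
  \<open>z < x + P\<close> keeps them within one period.\<close>

definition three_fixed :: "real \<Rightarrow> (real \<Rightarrow> real) \<Rightarrow> bool"
  where "three_fixed P F \<longleftrightarrow>
    (\<exists>x y z. x < y \<and> y < z \<and> z < x + P \<and> F x = x \<and> F y = y \<and> F z = z)"

lemma fixed_closed:
  fixes F :: "real \<Rightarrow> real"
  assumes "strict_mono F" "surj F" "X \<longlonglongrightarrow> l" "\<And>n. F (X n) = X n"
  shows "F l = l"
proof -
  have "(\<lambda>n. F (X n)) \<longlonglongrightarrow> F l"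
    using increasing_surj_continuous[OF assms(1,2)] assms(3)
    by (rule continuous_on_tendsto_compose) auto
  then show ?thesis using assms(3,4) LIMSEQ_unique by simp
qed

lemma closed_fixed_points:
  fixes F :: "real \<Rightarrow> real"
  assumes "strict_mono F" "surj F"
  shows "closed {x. F x = x}"
  using increasing_surj_continuous[OF assms] by (intro closed_Collect_eq continuous_on_id)

lemma free_arc_exists:
  fixes F :: "real \<Rightarrow> real"
  assumes F: "strict_mono F" "surj F" and fixed: "F a = a" "F b = b" and x: "a < x" "x < b" "F x \<noteq> x"
  obtains u v where "free_arc F u v" "a \<le> u" "u < x" "x < v" "v \<le> b"
proof -
  define A where "A = {y. F y = y} \<inter> {a..x}"
  define B where "B = {y. F y = y} \<inter> {x..b}"
  have "compact A" "compact B"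
    unfolding A_def B_def using closed_fixed_points[OF F] by (auto intro: closed_Int_compact)
  moreover have "a \<in> A" "b \<in> B" using x fixed by (auto simp: A_def B_def)
  ultimately obtain u v where u: "u \<in> A" "\<And>y. y \<in> A \<Longrightarrow> y \<le> u" and v: "v \<in> B" "\<And>y. y \<in> B \<Longrightarrow> v \<le> y"
    using compact_attains_sup[of A] compact_attains_inf[of B] by blast
  have ux: "a \<le> u" "u < x" "F u = u" using u(1) x(3) by (auto simp: A_def less_le)
  have vx: "v \<le> b" "x < v" "F v = v" using v(1) x(3) by (auto simp: B_def less_le)
  have "F y \<noteq> y" if "u < y" "y < v" for y
  proof
    assume "F y = y"
    then have "y \<le> u" if "y \<le> x" using u(2)[of y] that \<open>u < y\<close> ux by (auto simp: A_def)
    moreover have "v \<le> y" if "x \<le> y" using v(2)[of y] that \<open>y < v\<close> vx \<open>F y = y\<close> by (auto simp: B_def)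
    ultimately show False using that by linarith
  qed
  then have "free_arc F u v" using ux vx by (auto simp: free_arc_def)
  then show ?thesis using that ux vx by blast
qed

lemma free_arc_sign:
  fixes F :: "real \<Rightarrow> real"
  assumes F: "strict_mono F" "surj F" and arc: "free_arc F u v"
    and y: "u < y" "y < v" "y < F y" and z: "u < z" "z < v"
  shows "z < F z"
proof (rule ccontr)
  assume "\<not> ?thesis"
  then have Fz: "F z \<le> z" by simp
  have cont: "continuous_on A (\<lambda>x. F x - x)" for A
    using increasing_surj_continuous[OF F]
    by (intro continuous_intros) (meson continuous_on_subset subset_UNIV)
  have "\<exists>w. min y z \<le> w \<and> w \<le> max y z \<and> F w - w = 0"
  proof (cases "y \<le> z")
    case True
    then show ?thesis using IVT2'[of "\<lambda>x. F x - x" z 0 y] cont y Fz by auto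
  next
    case False
    then show ?thesis using IVT'[of "\<lambda>x. F x - x" z 0 y] cont y Fz by auto
  qed
  then obtain w where "min y z \<le> w" "w \<le> max y z" "F w = w" by auto
  moreover from this have "u < w" "w < v" using y z by linarith+
  ultimately show False using arc by (auto simp: free_arc_def)
qed

locale lifted_lamination =
  fixes P :: real and L :: "(real \<times> real) set"
  assumes P_pos: "P > 0"
    and bounds: "(s, t) \<in> L \<Longrightarrow> s < t \<and> t < s + P"
    and rotate: "(s, t) \<in> L \<longleftrightarrow> (t, s + P) \<in> L"
    and closed: "(\<And>n. (X n, Y n) \<in> L) \<Longrightarrow> X \<longlonglongrightarrow> a \<Longrightarrow> Y \<longlonglongrightarrow> b \<Longrightarrow> a < b \<Longrightarrow> b < a + P \<Longrightarrow> (a, b) \<in> L"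
    and unlinked: "(s, t) \<in> L \<Longrightarrow> (s', t') \<in> L \<Longrightarrow> s < s' \<Longrightarrow> s' < t \<Longrightarrow> t < t' \<Longrightarrow> t' < s + P \<Longrightarrow> False"
    and rainbow: "x \<notin> fst ` L \<Longrightarrow> e > 0 \<Longrightarrow> \<exists>c d. (c, d) \<in> L \<and> x - e < c \<and> c < x \<and> x < d \<and> d < x + e"
    and not_three_leaves: "(s, t1) \<in> L \<Longrightarrow> (s, t2) \<in> L \<Longrightarrow> (s, t3) \<in> L \<Longrightarrow> t1 < t2 \<Longrightarrow> t2 < t3 \<Longrightarrow> False"

locale lifted_pair = A: lifted_lamination P L + B: lifted_lamination P L' for P L L' +
  assumes disjoint: "(x, y) \<in> L \<Longrightarrow> (x, z) \<in> L' \<Longrightarrow> False"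

definition pair_aut :: "real \<Rightarrow> (real \<times> real) set \<Rightarrow> (real \<times> real) set \<Rightarrow> (real \<Rightarrow> real) \<Rightarrow> bool"
  where "pair_aut P L L' F \<longleftrightarrow> strict_mono F \<and> surj F \<and> (\<forall>x. F (x + P) = F x + P) \<and>
    (\<forall>s t. (s, t) \<in> L \<longleftrightarrow> (F s, F t) \<in> L) \<and> (\<forall>s t. (s, t) \<in> L' \<longleftrightarrow> (F s, F t) \<in> L')"

lemma pair_aut_swap: "pair_aut P L L' F \<Longrightarrow> pair_aut P L' L F"
  by (auto simp: pair_aut_def)

lemma pair_autD:
  assumes "pair_aut P L L' F"
  shows "strict_mono F" "surj F" "F (x + P) = F x + P" "F (x - P) = F x - P"
    "F x < F y \<longleftrightarrow> x < y" "inv_map F (F x) = x" "F (inv_map F x) = x"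
proof -
  show sm: "strict_mono F" and su: "surj F" and per: "F (x + P) = F x + P" for x
    using assms by (auto simp: pair_aut_def)
  show "F (x - P) = F x - P" using per[of "x - P"] by simp
  show "F x < F y \<longleftrightarrow> x < y" using sm by (rule strict_mono_less)
  show "inv_map F (F x) = x" using sm by (meson inv_f_f strict_mono_imp_inj_on)
  show "F (inv_map F x) = x" using su by (rule surj_f_inv_f)
qed

lemma pair_aut_inv:
  assumes "pair_aut P L L' F"
  shows "pair_aut P L L' (inv_map F)" "inv_map F x = x \<longleftrightarrow> F x = x"
proof -
  note D = pair_autD[OF assms]
  have per: "inv_map F (x + P) = inv_map F x + P" for x
    using D(6)[of "inv_map F x + P"] D(3)[of "inv_map F x"] D(7)[of x] by simp
  have "(s, t) \<in> L \<longleftrightarrow> (inv_map F s, inv_map F t) \<in> L" "(s, t) \<in> L' \<longleftrightarrow> (inv_map F s, inv_map F t) \<in> L'" for s t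
    using assms D(7)[of s] D(7)[of t] unfolding pair_aut_def by metis+
  then show "pair_aut P L L' (inv_map F)"
    unfolding pair_aut_def using per strict_mono_inv_real[OF D(1,2)] by blast
  show "inv_map F x = x \<longleftrightarrow> F x = x" using D(6)[of x] D(7)[of x] by auto
qed

lemma pair_aut_funpow:
  assumes "pair_aut P L L' F"
  shows "(s, t) \<in> L \<Longrightarrow> ((F ^^ n) s, (F ^^ n) t) \<in> L" "(s, t) \<in> L' \<Longrightarrow> ((F ^^ n) s, (F ^^ n) t) \<in> L'"
  using assms by (induction n) (auto simp: pair_aut_def)

lemma translation_of_int:
  fixes F :: "real \<Rightarrow> real"
  assumes "\<And>x. F (x + P) = F x + P"
  shows "F (x + of_int k * P) = F x + of_int k * P"
proof -
  have n: "F (y + of_nat n * P) = F y + of_nat n * P" for y n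
  proof (induction n)
    case (Suc n) then show ?case using assms[of "y + of_nat n * P"] by (simp add: algebra_simps)
  qed simp
  show ?thesis
  proof (cases k)
    case (nonneg m) then show ?thesis using n[of x m] by simp
  next
    case (neg m)
    then have "real_of_int k * P = - (of_nat (Suc m) * P)" by (simp add: left_diff_distrib distrib_right)
    then show ?thesis using n[of "x - of_nat (Suc m) * P" "Suc m"] by simp
  qed
qed

lemma fixed_shift:
  assumes "pair_aut P L L' F" "F x = x"
  shows "F (x + of_int k * P) = x + of_int k * P"
  using translation_of_int[of F P x k] pair_autD(3)[OF assms(1)] assms(2) by simp

lemma fixed_pm:
  assumes "pair_aut P L L' F"
  shows "F (x + P) = x + P \<longleftrightarrow> F x = x" "F (x - P) = x - P \<longleftrightarrow> F x = x"
  using pair_autD(3,4)[OF assms] by auto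

lemma representative:
  fixes p x P :: real assumes "P > 0"
  obtains k :: int where "p \<le> x + of_int k * P" "x + of_int k * P < p + P"
proof -
  define k where "k = - \<lfloor>(x - p) / P\<rfloor>"
  have "of_int (-k) \<le> (x - p) / P" "(x - p) / P < of_int (-k) + 1" by (simp_all add: k_def)
  then have "of_int (-k) * P \<le> x - p" "x - p < (of_int (-k) + 1) * P"
    using assms by (simp_all add: pos_le_divide_eq pos_divide_less_eq)
  then show ?thesis using that[of k] by (simp add: algebra_simps)
qed

section \<open>Components of the complement of the fixed points, and pushing towards their
  ends\<close>

lemma free_arc_unique_right: "free_arc F x v \<Longrightarrow> free_arc F x v' \<Longrightarrow> v = v'"
  unfolding free_arc_def by (metis linorder_neqE_linordered_idom)

lemma free_arc_unique_left: "free_arc F u x \<Longrightarrow> free_arc F u' x \<Longrightarrow> u = u'"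
  unfolding free_arc_def by (metis linorder_neqE_linordered_idom)

lemma free_arc_fixed: "free_arc F u v \<Longrightarrow> F y = y \<Longrightarrow> y \<le> u \<or> v \<le> y"
  unfolding free_arc_def by force

lemma free_arc_shift:
  assumes "pair_aut P L L' F" "free_arc F u v"
  shows "free_arc F (u + of_int k * P) (v + of_int k * P)"
proof -
  have "F (x - of_int k * P) = x - of_int k * P" if "F x = x" for x
    using fixed_shift[OF assms(1) that, of "-k"] by simp
  then have "F x \<noteq> x" if "u + of_int k * P < x" "x < v + of_int k * P" for x
    using assms(2) that unfolding free_arc_def
    by (metis add_diff_cancel_right' diff_strict_right_mono)
  then show ?thesis using fixed_shift[OF assms(1), of _ k] assms(2) by (auto simp: free_arc_def)
qed

lemma free_arc_inv: "pair_aut P L L' F \<Longrightarrow> free_arc (inv_map F) u v \<longleftrightarrow> free_arc F u v"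
  by (simp add: free_arc_def pair_aut_inv)

text \<open>An automorphism and its inverse have the same fixed points, and one of the two moves
  \<open>d\<close> up; choosing it as \<open>K\<close> removes a case distinction on the
  direction.\<close>

lemma push_up:
  assumes F: "pair_aut P L L' F" and arc: "free_arc F u v" and d: "u < d" "d < v"
  obtains K where "pair_aut P L L' K" "\<forall>x. K x = x \<longleftrightarrow> F x = x"
    "(\<lambda>n. (K ^^ n) d) \<longlonglongrightarrow> v" "d < K d"
proof -
  define K where "K = (if d < F d then F else inv_map F)"
  have K: "pair_aut P L L' K" "\<forall>x. K x = x \<longleftrightarrow> F x = x"
    using F pair_aut_inv[OF F] by (auto simp: K_def)
  have "F d \<noteq> d" using arc d by (auto simp: free_arc_def)
  then have dK: "d < K d"
    using pair_autD(5)[OF F, of d "inv_map F d"] by (auto simp: K_def pair_autD(7)[OF F])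
  have Kv: "K v = v" using K arc by (simp add: free_arc_def)
  obtain y where y: "(\<lambda>n. (K ^^ n) d) \<longlonglongrightarrow> y" "K y = y" "d < y" "y \<le> v"
    using iterate_converges_up[OF pair_autD(1,2)[OF K(1)] Kv, of d] d dK by auto
  then have "y = v" using free_arc_fixed[OF arc, of y] K(2) d by auto
  then show ?thesis using that K dK y by blast
qed

lemma push_down:
  assumes F: "pair_aut P L L' F" and arc: "free_arc F u v" and d: "u < d" "d < v" "F d < d"
  shows "(\<lambda>n. (F ^^ n) d) \<longlonglongrightarrow> u"
proof -
  have "F u = u" using arc by (simp add: free_arc_def)
  then obtain y where y: "(\<lambda>n. (F ^^ n) d) \<longlonglongrightarrow> y" "F y = y" "y < d" "u \<le> y"
    using iterate_converges_down[OF pair_autD(1,2)[OF F], of u d] d by auto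
  then have "y = u" using free_arc_fixed[OF arc, of y] d by auto
  then show ?thesis using y by blast
qed

lemma push_up':
  assumes F: "pair_aut P L L' F" and arc: "free_arc F u v" and d: "u < d" "d < v" "d < F d"
  shows "(\<lambda>n. (F ^^ n) d) \<longlonglongrightarrow> v"
proof -
  have "F v = v" using arc by (simp add: free_arc_def)
  then obtain y where y: "(\<lambda>n. (F ^^ n) d) \<longlonglongrightarrow> y" "F y = y" "d < y" "y \<le> v"
    using iterate_converges_up[OF pair_autD(1,2)[OF F], of v d] d by auto
  then have "y = v" using free_arc_fixed[OF arc, of y] d by auto
  then show ?thesis using y by blast
qed

text \<open>For the second end of a leaf whose first end is being pushed: its orbit is monotone in
  some direction, so the pushed leaves converge.\<close>

lemma orbit_limit:
  assumes F: "pair_aut P L L' F" and ab: "F a = a" "F b = b" "a \<le> c" "c \<le> b"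
  obtains y where "(\<lambda>n. (F ^^ n) c) \<longlonglongrightarrow> y" "a \<le> y" "y \<le> b"
proof -
  consider "F c = c" | "c < F c" | "F c < c" by linarith
  then show ?thesis
  proof cases
    case 1
    then have "(F ^^ n) c = c" for n by (induction n) auto
    then show ?thesis using that[of c] ab by simp
  next
    case 2
    then obtain y where "(\<lambda>n. (F ^^ n) c) \<longlonglongrightarrow> y" "c < y" "y \<le> b"
      using iterate_converges_up[OF pair_autD(1,2)[OF F] ab(2,4)] by auto
    then show ?thesis using that[of y] ab by simp
  next
    case 3
    then obtain y where "(\<lambda>n. (F ^^ n) c) \<longlonglongrightarrow> y" "y < c" "a \<le> y"
      using iterate_converges_down[OF pair_autD(1,2)[OF F] ab(1,3)] by auto
    then show ?thesis using that[of y] ab by simp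
  qed
qed

context lifted_pair
begin

abbreviation "aut \<equiv> pair_aut P L L'"

lemma swap: "lifted_pair P L' L"
  by unfold_locales (use disjoint in blast)

lemma fst_L: "x \<in> fst ` L \<longleftrightarrow> (\<exists>y. (x, y) \<in> L)" by force
lemma fst_L': "x \<in> fst ` L' \<longleftrightarrow> (\<exists>y. (x, y) \<in> L')" by force

section \<open>Leaves near adjacent fixed points\<close>

lemma three_fixed_around:
  assumes F: "aut F" and three: "three_fixed P F" and x: "F x = x"
  obtains y z where "x < y" "y < z" "z < x + P" "F y = y" "F z = z"
proof -
  obtain p q r where pqr: "p < q" "q < r" "r < p + P" "F p = p" "F q = q" "F r = r"
    using three by (auto simp: three_fixed_def)
  obtain k where k: "p \<le> x + of_int k * P" "x + of_int k * P < p + P"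
    using representative[OF A.P_pos] .
  define d where "d = of_int k * P"
  have sh: "F (w - d) = w - d" if "F w = w" for w
    using fixed_shift[OF F that, of "-k"] by (simp add: d_def)
  have shP: "F (w + P) = w + P" if "F w = w" for w
    using that fixed_pm(1)[OF F] by simp
  note goal = that
  have res: thesis if "x + d < y" "y < z" "z < x + d + P" "F y = y" "F z = z" for y z
  proof (rule goal[of "y - d" "z - d"])
    show "F (y - d) = y - d" "F (z - d) = z - d" using sh that by auto
  qed (use that in linarith)+
  consider "x + d < q" | "q \<le> x + d" "x + d < r" | "r \<le> x + d" by linarith
  then show thesis
  proof cases
    case 1 then show ?thesis using res[of q r] pqr k by (simp add: d_def)
  next
    case 2 then show ?thesis using res[of r "p + P"] pqr k shP by (simp add: d_def)
  next
    case 3 then show ?thesis using res[of "p + P" "q + P"] pqr k shP by (simp add: d_def)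
  qed
qed

text \<open>The point \<open>w\<close> is a barrier on the other side of the circle: orbits cannot
  pass it, so limits of pushed leaves keep two distinct ends.\<close>

lemma free_arc_third:
  assumes F: "aut F" and three: "three_fixed P F" and arc: "free_arc F u v"
  obtains w where "v < w" "w < u + P" "F w = w"
proof -
  obtain y z where yz: "u < y" "y < z" "z < u + P" "F y = y" "F z = z"
    using three_fixed_around[OF F three, of u] arc by (auto simp: free_arc_def)
  then have "v \<le> y" using free_arc_fixed[OF arc, of y] by auto
  then show ?thesis using that[of z] yz by simp
qed

text \<open>Pushing a small leaf of \<open>L'\<close> around \<open>u\<close> by an element moving \<open>(u, v)\<close> towards \<open>v\<close>
  produces in the limit a leaf of \<open>L'\<close> ending at \<open>v\<close>.\<close>

lemma free_arc_ends:
  assumes F: "aut F" and three: "three_fixed P F" and arc: "free_arc F u v"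
    and L: "(u, y) \<in> L" "(v, z) \<in> L"
  shows False
proof -
  obtain w where w: "v < w" "w < u + P" "F w = w" using free_arc_third[OF F three arc] .
  have uv: "u < v" "F u = u" "F v = v" using arc by (auto simp: free_arc_def)
  have "u \<notin> fst ` L'" using L disjoint fst_L' by blast
  \<comment> \<open>The leaf is short enough that \<open>c\<close> lies between the fixed points
    \<open>w - P\<close> and \<open>u\<close>. The limit of the orbit of \<open>c\<close> stays
    there, less than one period before \<open>v\<close>.\<close>
  from B.rainbow[OF this, of "min (v - u) (u + P - w)"]
  obtain c d where cd: "(c, d) \<in> L'" "w - P < c" "c < u" "u < d" "d < v"
    using uv w by auto
  obtain K where K: "aut K" "\<forall>x. K x = x \<longleftrightarrow> F x = x" "(\<lambda>n. (K ^^ n) d) \<longlonglongrightarrow> v"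
    using push_up[OF F arc cd(4,5)] by blast
  obtain c' where c': "(\<lambda>n. (K ^^ n) c) \<longlonglongrightarrow> c'" "w - P \<le> c'" "c' \<le> u"
    using orbit_limit[OF K(1), of "w - P" u c] K(2) fixed_pm[OF F] w uv cd by auto
  have "(c', v) \<in> L'"
    using B.closed[OF pair_aut_funpow(2)[OF K(1) cd(1)] c'(1) K(3)] c' uv w by simp
  then show False using B.rotate disjoint L(2) by blast
qed

text \<open>If \<open>t\<close> stayed fixed, pushing \<open>s\<close> both ways would give leaves
  from \<open>t\<close> to \<open>v\<close> and from \<open>t\<close> to \<open>u\<close>. One of
  the two limits may degenerate, when \<open>t\<close> is \<open>v\<close> or \<open>u + P\<close>,
  but then the other one joins \<open>u\<close> and \<open>v\<close>. In each case both ends of a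
  free arc are endpoints of \<open>L\<close>, against \<open>free_arc_ends\<close>.\<close>

lemma leaf_one_end_moved:
  assumes F: "aut F" and three: "three_fixed P F" and arc: "free_arc F u v"
    and leaf: "(s, t) \<in> L" "u < s" "s < v"
  shows "F t \<noteq> t"
proof
  assume t: "F t = t"
  have uv: "u < v" "F u = u" "F v = v" using arc by (auto simp: free_arc_def)
  obtain w where w: "v < w" "w < u + P" "F w = w" using free_arc_third[OF F three arc] .
  have st: "s < t" "t < s + P" using A.bounds[OF leaf(1)] by auto
  have "v \<le> t" using free_arc_fixed[OF arc t] leaf st by linarith
  have "t \<le> u + P"
  proof (rule ccontr)
    assume "\<not> ?thesis"
    then have "u < t - P" "t - P < v" using st leaf by auto
    then show False using t arc fixed_pm(2)[OF F, of t] by (auto simp: free_arc_def)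
  qed
  obtain K where K: "aut K" "\<forall>x. K x = x \<longleftrightarrow> F x = x" "(\<lambda>n. (K ^^ n) s) \<longlonglongrightarrow> v" "s < K s"
    using push_up[OF F arc leaf(2,3)] .
  have fix_pow: "(f ^^ n) t = t" if "f t = t" for f :: "real \<Rightarrow> real" and n
    using that by (induction n) auto
  have J: "aut (inv_map K)" using pair_aut_inv[OF K(1)] by blast
  have arcJ: "free_arc (inv_map K) u v"
    using arc K(2) by (simp add: free_arc_def pair_aut_inv(2)[OF K(1)])
  have "inv_map K s < s" using K(4) pair_autD(5)[OF K(1), of "inv_map K s" s] by (simp add: pair_autD(7)[OF K(1)])
  then have Js: "(\<lambda>n. (inv_map K ^^ n) s) \<longlonglongrightarrow> u" using push_down[OF J arcJ leaf(2,3)] by blast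
  have Kt: "K t = t" "inv_map K t = t" using t K(2) pair_aut_inv(2)[OF K(1)] by auto
  have vt: "(v, t) \<in> L" if "t \<noteq> v"
    using A.closed[OF pair_aut_funpow(1)[OF K(1) leaf(1)] K(3), of t] fix_pow[of K, OF Kt(1)]
      that \<open>v \<le> t\<close> \<open>t \<le> u + P\<close> uv by simp
  have ut: "(u, t) \<in> L" if "t \<noteq> u + P"
    using A.closed[OF pair_aut_funpow(1)[OF J leaf(1)] Js, of t] fix_pow[of "inv_map K", OF Kt(2)]
      that \<open>v \<le> t\<close> \<open>t \<le> u + P\<close> uv by simp
  consider "t = v" | "t = u + P" | "t \<noteq> v" "t \<noteq> u + P" by blast
  then show False
  proof cases
    case 1
    then have "(u, v) \<in> L" using ut w by auto
    then show ?thesis using free_arc_ends[OF F three arc] A.rotate by blast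
  next
    case 2
    then have "(v, u + P) \<in> L" using vt w by auto
    then show ?thesis using free_arc_ends[OF F three arc] A.rotate by blast
  next
    case 3
    then show ?thesis using free_arc_ends[OF F three arc] ut vt by blast
  qed
qed

text \<open>Since a leaf does not cross its image, its two ends move in opposite directions. Pushing
  one way gives a leaf from \<open>u\<close> to \<open>v'\<close>, pushing the other way one from
  \<open>v\<close> to \<open>u'\<close>. The second must degenerate, because \<open>u\<close> and
  \<open>v\<close> are adjacent fixed points.\<close>

lemma leaf_ends_moved:
  assumes F: "aut F" and three: "three_fixed P F"
    and arc: "free_arc F u v" and arc': "free_arc F u' v'"
    and leaf: "(s, t) \<in> L" "u < s" "s < v" "u' < t" "t < v'" and le: "v \<le> u'" "v' < u + P"
  shows "v = u' \<and> (u, v') \<in> L"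
proof -
  have uv: "u < v" "F u = u" "F v = v" using arc by (auto simp: free_arc_def)
  have uv': "u' < v'" "F u' = u'" "F v' = v'" using arc' by (auto simp: free_arc_def)
  obtain K where K: "aut K" "\<forall>x. K x = x \<longleftrightarrow> F x = x" "(\<lambda>n. (K ^^ n) s) \<longlonglongrightarrow> v" "s < K s"
    using push_up[OF F arc leaf(2,3)] .
  have arcK: "free_arc K u v" "free_arc K u' v'" using arc arc' K(2) by (auto simp: free_arc_def)
  have J: "aut (inv_map K)" using pair_aut_inv[OF K(1)] by blast
  have arcJ: "free_arc (inv_map K) u v" "free_arc (inv_map K) u' v'"
    using arcK free_arc_inv[OF K(1)] by auto
  have "K s < v" using pair_autD(5)[OF K(1), of s v] leaf(3) uv spec[OF K(2), of v] by simp
  have "K t < v'" using pair_autD(5)[OF K(1), of t v'] leaf(5) uv' spec[OF K(2), of v'] by simp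
  \<comment> \<open>If both ends moved up, then s < K s < t < K t within one period, and the leaf
    would cross its image.\<close>
  have "\<not> t < K t"
  proof
    assume "t < K t"
    moreover have "(K s, K t) \<in> L" using K(1) leaf(1) by (auto simp: pair_aut_def)
    ultimately show False
      using A.unlinked[OF leaf(1), of "K s" "K t"] K(4) \<open>K s < v\<close> \<open>K t < v'\<close> le leaf by linarith
  qed
  moreover have "K t \<noteq> t" using arcK(2) leaf by (auto simp: free_arc_def)
  ultimately have Kt: "K t < t" by simp
  have l1: "(\<lambda>n. (K ^^ n) t) \<longlonglongrightarrow> u'" by (rule push_down[OF K(1) arcK(2) leaf(4,5) Kt])
  have "inv_map K s < s" using K(4) pair_autD(5)[OF K(1), of "inv_map K s" s] by (simp add: pair_autD(7)[OF K(1)])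
  then have Js: "(\<lambda>n. (inv_map K ^^ n) s) \<longlonglongrightarrow> u" using push_down[OF J arcJ(1) leaf(2,3)] by blast
  have "t < inv_map K t" using Kt pair_autD(5)[OF K(1), of t "inv_map K t"] by (simp add: pair_autD(7)[OF K(1)])
  then have Jt: "(\<lambda>n. (inv_map K ^^ n) t) \<longlonglongrightarrow> v'" using push_up'[OF J arcJ(2) leaf(4,5)] by blast
  have uv'L: "(u, v') \<in> L"
    using A.closed[OF pair_aut_funpow(1)[OF J leaf(1)] Js Jt] uv uv' le by simp
  moreover have "v = u'"
  proof (rule ccontr)
    assume "v \<noteq> u'"
    then have "(v, u') \<in> L"
      using A.closed[OF pair_aut_funpow(1)[OF K(1) leaf(1)] K(3) l1] le uv uv' by simp
    then show False using free_arc_ends[OF F three arc uv'L] by blast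
  qed
  ultimately show ?thesis by blast
qed

text \<open>If one end moves, both do by \<open>leaf_one_end_moved\<close>, and the free arcs
  containing them must share an end, which can only be \<open>x\<close>. The fixed points
  \<open>w1\<close> and \<open>w2\<close> confine these arcs so that together they are shorter than
  a period.\<close>

lemma small_leaf_moved:
  assumes F: "aut F" and three: "three_fixed P F" and x: "F x = x"
    and leaf: "(c, d) \<in> L" "c < x" "x < d" and w: "F w1 = w1" "F w2 = w2" "d < w1" "w1 < w2" "w2 < c + P"
    and moved: "F c \<noteq> c \<or> F d \<noteq> d"
  obtains u v where "free_arc F u x" "free_arc F x v" "(u, v) \<in> L"
proof -
  note S = pair_autD(1,2)[OF F]
  have "F c \<noteq> c"
  proof
    assume c: "F c = c"
    then have d: "F d \<noteq> d" using moved by simp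
    obtain u v where "free_arc F u v" "u < d" "d < v"
      using free_arc_exists[OF S x w(1) leaf(3) w(3) d] by blast
    then show False
      using leaf_one_end_moved[OF F three, of u v d "c + P"] leaf A.rotate c fixed_pm(1)[OF F] by blast
  qed
  moreover have "F (w2 - P) = w2 - P" using w fixed_pm(2)[OF F] by blast
  ultimately obtain u v where uv: "free_arc F u v" "w2 - P \<le> u" "u < c" "c < v" "v \<le> x"
    using free_arc_exists[OF S _ x, of "w2 - P" c] w leaf by auto
  have "F d \<noteq> d" using leaf_one_end_moved[OF F three uv(1) leaf(1) uv(3,4)] .
  then obtain u' v' where uv': "free_arc F u' v'" "x \<le> u'" "u' < d" "d < v'" "v' \<le> w1"
    using free_arc_exists[OF S x w(1) leaf(3) w(3)] by blast
  have "v = u' \<and> (u, v') \<in> L"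
    by (rule leaf_ends_moved[OF F three uv(1) uv'(1) leaf(1) uv(3,4) uv'(3,4)]) (use uv uv' w in linarith)+
  moreover from this have "v = x" "u' = x" using uv uv' by auto
  ultimately show ?thesis using that uv(1) uv'(1) by blast
qed

text \<open>A leaf around \<open>x\<close> that is shorter than \<open>e\<close> on each side has an
  end in the fixed-point-free side. That end moves, and \<open>small_leaf_moved\<close> controls
  both sides at once.\<close>

lemma isolated_if_one_sided:
  assumes F: "aut F" and three: "three_fixed P F" and x: "F x = x" "x \<notin> fst ` L" and e: "e > 0"
    "(\<forall>y. x < y \<and> y < x + e \<longrightarrow> F y \<noteq> y) \<or> (\<forall>y. x - e < y \<and> y < x \<longrightarrow> F y \<noteq> y)"
  obtains u v where "free_arc F u x" "free_arc F x v" "(u, v) \<in> L"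
proof -
  obtain w1 w2 where w: "x < w1" "w1 < w2" "w2 < x + P" "F w1 = w1" "F w2 = w2"
    using three_fixed_around[OF F three x(1)] .
  obtain c d where cd: "(c, d) \<in> L" "c < x" "x < d" "d < w1" "w2 < c + P" "x - e < c" "d < x + e"
    using A.rainbow[OF x(2), of "min e (min (w1 - x) (x + P - w2))"] w e by auto
  have "F c \<noteq> c \<or> F d \<noteq> d" using e cd by blast
  then show ?thesis using small_leaf_moved[OF F three x(1) cd(1-3) w(4,5) cd(4) w(2) cd(5)] that by blast
qed

lemma next_leaf:
  assumes F: "aut F" and three: "three_fixed P F" and x: "x \<notin> fst ` L" and arc: "free_arc F x v"
  obtains u where "free_arc F u x" "(u, v) \<in> L"
proof -
  have "F x = x" "v - x > 0" "\<forall>y. x < y \<and> y < x + (v - x) \<longrightarrow> F y \<noteq> y"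
    using arc by (auto simp: free_arc_def)
  then obtain u v' where "free_arc F u x" "free_arc F x v'" "(u, v') \<in> L"
    using isolated_if_one_sided[OF F three _ x] by blast
  then show ?thesis using that free_arc_unique_right[OF arc] by blast
qed

lemma prev_leaf:
  assumes F: "aut F" and three: "three_fixed P F" and x: "x \<notin> fst ` L" and arc: "free_arc F u x"
  obtains v where "free_arc F x v" "(u, v) \<in> L"
proof -
  have "F x = x" "x - u > 0" "\<forall>y. x - (x - u) < y \<and> y < x \<longrightarrow> F y \<noteq> y"
    using arc by (auto simp: free_arc_def)
  then obtain u' v where "free_arc F u' x" "free_arc F x v" "(u', v) \<in> L"
    using isolated_if_one_sided[OF F three _ x] by blast
  then show ?thesis using that free_arc_unique_left[OF arc] by blast
qed

section \<open>Isolation of fixed points\<close>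

definition isolated :: "(real \<Rightarrow> real) \<Rightarrow> real \<Rightarrow> bool"
  where "isolated F x \<longleftrightarrow> (\<exists>u v. free_arc F u x \<and> free_arc F x v)"

lemma not_both_ends: "x \<notin> fst ` L \<or> x \<notin> fst ` L'"
  using disjoint fst_L fst_L' by blast

text \<open>Distinct endpoints free the previous argument of its condition on \<open>x\<close>: it
  runs in whichever lamination does not end at \<open>x\<close>.\<close>

lemma isolated_one_sided:
  assumes F: "aut F" and three: "three_fixed P F" and x: "F x = x" and e: "e > 0"
    "(\<forall>y. x < y \<and> y < x + e \<longrightarrow> F y \<noteq> y) \<or> (\<forall>y. x - e < y \<and> y < x \<longrightarrow> F y \<noteq> y)"
  shows "isolated F x"
proof -
  interpret S: lifted_pair P L' L by (rule swap)
  show ?thesis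
    using isolated_if_one_sided[OF F three x _ e] S.isolated_if_one_sided[OF pair_aut_swap[OF F] three x _ e]
      not_both_ends[of x] unfolding isolated_def by metis
qed

lemma isolated_right: "aut F \<Longrightarrow> three_fixed P F \<Longrightarrow> free_arc F x v \<Longrightarrow> isolated F x"
  using isolated_one_sided[of F x "v - x"] by (auto simp: free_arc_def)

lemma isolated_left: "aut F \<Longrightarrow> three_fixed P F \<Longrightarrow> free_arc F u x \<Longrightarrow> isolated F x"
  using isolated_one_sided[of F x "x - u"] by (auto simp: free_arc_def)

lemma isolated_shift: "aut F \<Longrightarrow> isolated F x \<Longrightarrow> isolated F (x + of_int k * P)"
  unfolding isolated_def using free_arc_shift by blast

text \<open>A non-isolated fixed point \<open>w\<close> approached from the left by isolated ones is enclosed in a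
  leaf that ends at some isolated \<open>c\<close>. The leaves joining \<open>c\<close> to its second neighbours on both
  sides would make it the middle one of three leaves at \<open>c\<close>.\<close>

lemma no_first_accumulation:
  assumes F: "aut F" and three: "three_fixed P F"
    and w: "F w = w" "\<not> isolated F w" "a0 < w" and before: "\<And>x. a0 < x \<Longrightarrow> x < w \<Longrightarrow> F x = x \<Longrightarrow> isolated F x"
    and wL: "w \<notin> fst ` L"
  shows False
proof -
  interpret S: lifted_pair P L' L by (rule swap)
  note F' = pair_aut_swap[OF F]
  have acc: "\<exists>y. w - e < y \<and> y < w \<and> F y = y" if "e > 0" for e
    using isolated_one_sided[OF F three w(1) that] w(2) by blast
  obtain a1 where a1: "a0 < a1" "w - P < a1" "a1 < w" "F a1 = a1"
  proof -
    obtain y where "w - min (w - a0) P < y" "y < w" "F y = y"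
      using acc[of "min (w - a0) P"] w(3) A.P_pos by auto
    then show ?thesis using that[of y] by linarith
  qed
  obtain a2 where a2: "a1 < a2" "a2 < w" "F a2 = a2"
    using acc[of "w - a1"] a1 by auto
  obtain w1 w2 where ww: "w < w1" "w1 < w2" "w2 < w + P" "F w1 = w1" "F w2 = w2"
    using three_fixed_around[OF F three w(1)] .
  obtain c d where cd: "(c, d) \<in> L" "c < w" "w < d" "d < w1" "w2 < c + P" "a2 < c" "d < a1 + P"
    using A.rainbow[OF wL, of "min (min (w - a2) (a1 + P - w)) (min (w1 - w) (w + P - w2))"]
      ww a1 a2 by auto
  \<comment> \<open>If \<open>c\<close> moved, the leaf around \<open>w\<close> would isolate
    \<open>w\<close>.\<close>
  have "F c = c"
    using small_leaf_moved[OF F three w(1) cd(1-3) ww(4,5) cd(4) ww(2) cd(5)] w(2)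
    unfolding isolated_def by blast
  then have "isolated F c" using before cd a1 a2 by auto
  then obtain u v where uv: "free_arc F u c" "free_arc F c v" unfolding isolated_def by blast
  \<comment> \<open>The laminations now alternate: \<open>c\<close> ends a leaf of \<open>L\<close>,
    so its neighbours \<open>u\<close> and \<open>v\<close> are joined in \<open>L'\<close>; so
    these are not endpoints of \<open>L\<close>, and \<open>L\<close> joins \<open>c\<close> to the
    next fixed points \<open>v2\<close> and \<open>u0\<close> beyond them.\<close>
  have "c \<notin> fst ` L'" using cd(1) disjoint fst_L' by blast
  then obtain u' where "free_arc F u' c" "(u', v) \<in> L'"
    using S.next_leaf[OF F' three _ uv(2)] by blast
  then have uvL: "(u, v) \<in> L'" using free_arc_unique_left[OF uv(1)] by blast
  have "v \<notin> fst ` L" using B.rotate uvL disjoint fst_L by blast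
  then obtain v2 where v2: "free_arc F v v2" "(c, v2) \<in> L" using prev_leaf[OF F three _ uv(2)] by blast
  have "u \<notin> fst ` L" using uvL disjoint fst_L by blast
  then obtain u0 where u0: "free_arc F u0 u" "(u0, c) \<in> L" using next_leaf[OF F three _ uv(1)] by blast
  have "a2 \<le> u" using free_arc_fixed[OF uv(1) a2(3)] cd by linarith
  then have "a1 \<le> u0" using free_arc_fixed[OF u0(1) a1(4)] a2 by linarith
  have "v \<le> w" using free_arc_fixed[OF uv(2) w(1)] cd by linarith
  moreover have "v \<noteq> w" using isolated_left[OF F three uv(2)] w by blast
  ultimately have "v < w" by simp
  then have "v2 \<le> w" using free_arc_fixed[OF v2(1) w(1)] by linarith
  moreover have "v2 \<noteq> w" using isolated_left[OF F three v2(1)] w by blast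
  ultimately have "v2 < d" using cd by simp
  \<comment> \<open>The guards \<open>a1\<close> and \<open>a2\<close> leave room for two fixed
    points before \<open>c\<close>, whence \<open>d < a1 + P \<le> u0 + P\<close>. So
    \<open>v2 < d < u0 + P\<close> are three different other ends of leaves at
    \<open>c\<close>.\<close>
  have "(c, u0 + P) \<in> L" using u0 A.rotate by blast
  then show False
    by (rule A.not_three_leaves[OF v2(2) cd(1) _ \<open>v2 < d\<close>]) (use \<open>a1 \<le> u0\<close> cd in linarith)
qed

text \<open>By countability some point moves, and the left end \<open>a0\<close> of its free arc is
  isolated. Beyond \<open>a0\<close>, the infimum \<open>w\<close> of the non-isolated fixed points
  would be a first accumulation point.\<close>

lemma all_isolated:
  assumes F: "aut F" and three: "three_fixed P F" and countable: "countable {x. F x = x}" and x: "F x = x"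
  shows "isolated F x"
proof (rule ccontr)
  assume nx: "\<not> isolated F x"
  interpret S: lifted_pair P L' L by (rule swap)
  note SS = pair_autD(1,2)[OF F]
  have "\<not> {x<..<x + P} \<subseteq> {x. F x = x}"
    using countable A.P_pos uncountable_open_interval[of x "x + P"] countable_subset by auto
  then obtain y where "y \<in> {x<..<x + P}" "y \<notin> {x. F x = x}" by blast
  then have y: "x < y" "y < x + P" "F y \<noteq> y" by simp_all
  obtain a0 v0 where "free_arc F a0 v0" "x \<le> a0" "a0 < y"
    using free_arc_exists[OF SS x _ y] x fixed_pm(1)[OF F] by metis
  then have a0: "isolated F a0" "F a0 = a0" "a0 < x + P"
    using isolated_right[OF F three] y by (auto simp: free_arc_def)
  obtain v1 where v1: "free_arc F a0 v1" using a0 by (auto simp: isolated_def)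
  have nxP: "\<not> isolated F (x + P)"
    using nx isolated_shift[OF F, of "x + P" "-1"] by auto
  define N where "N = {z. a0 < z \<and> F z = z \<and> \<not> isolated F z}"
  \<comment> \<open>The translate \<open>x + P\<close> serves as witness because \<open>a0\<close>
    was found at or after \<open>x\<close>, but before \<open>x + P\<close>.\<close>
  have xN: "x + P \<in> N" using nxP a0 x fixed_pm(1)[OF F] by (auto simp: N_def)
  have bdd: "bdd_below N" by (rule bdd_belowI[of _ a0]) (auto simp: N_def)
  define w where "w = Inf N"
  have lower: "w \<le> z" if "z \<in> N" for z using cInf_lower[OF that bdd] by (simp add: w_def)
  have near: "\<exists>z\<in>N. z < t" if "w < t" for t
    using cInf_less_iff[of N t] xN bdd that by (auto simp: w_def)
  have "v1 \<le> z" if "z \<in> N" for z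
    using that free_arc_fixed[OF v1, of z] by (auto simp: N_def)
  then have "v1 \<le> w" using xN by (auto simp: w_def intro: cInf_greatest)
  then have a0w: "a0 < w" using v1 by (auto simp: free_arc_def)
  have Fw: "F w = w"
  proof (rule ccontr)
    assume w: "F w \<noteq> w"
    then have "w < x + P" using lower[OF xN] x fixed_pm(1)[OF F, of x] by (auto simp: less_le)
    moreover have "F (x + P) = x + P" using x fixed_pm(1)[OF F] by simp
    ultimately obtain u v where "free_arc F u v" "u < w" "w < v"
      using free_arc_exists[OF SS a0(2) _ a0w _ w] by blast
    moreover from this obtain z where "z \<in> N" "z < v" using near by blast
    ultimately show False using lower[of z] by (auto simp: N_def free_arc_def)
  qed
  have "\<not> isolated F w"
  proof
    assume "isolated F w"
    then obtain v where v: "free_arc F w v" by (auto simp: isolated_def)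
    then obtain z where z: "z \<in> N" "z < v" using near by (auto simp: free_arc_def)
    then have "z \<noteq> w" using \<open>isolated F w\<close> by (auto simp: N_def)
    then show False using v z lower[of z] by (auto simp: N_def free_arc_def)
  qed
  moreover have "isolated F z" if "a0 < z" "z < w" "F z = z" for z
    using lower[of z] that by (auto simp: N_def)
  \<comment> \<open>\<open>no_first_accumulation\<close>, used once for each lamination, makes
    \<open>w\<close> an endpoint of both.\<close>
  ultimately have "w \<in> fst ` L" "S.isolated F w \<Longrightarrow> False"
    using no_first_accumulation[OF F three Fw _ a0w] by (auto simp: isolated_def S.isolated_def)
  moreover have "S.isolated F z" if "a0 < z" "z < w" "F z = z" for z
    using lower[of z] that by (auto simp: N_def isolated_def S.isolated_def)
  ultimately show False
    using S.no_first_accumulation[OF pair_aut_swap[OF F] three Fw _ a0w] not_both_ends by blast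
qed


text \<open>A short leaf around \<open>x\<close> with its ends in the two arcs has an image that
  again surrounds \<open>x\<close>. Being unlinked, the two are nested, so the ends move in opposite
  directions; the sign is constant along each arc.\<close>

lemma opposite_signs_aux:
  assumes F: "aut F" and arcs: "free_arc F u x" "free_arc F x v" and xL: "x \<notin> fst ` L"
    and y: "u < y" "y < x" and z: "x < z" "z < v"
  shows "y < F y \<longleftrightarrow> F z < z"
proof -
  note SS = pair_autD(1,2)[OF F]
  have ux: "u < x" "x < v" "F x = x" using arcs by (auto simp: free_arc_def)
  \<comment> \<open>Continuity keeps the image leaf within half a period of \<open>x\<close> on each
    side, so crossing can be tested by order on the line.\<close>
  obtain e where e: "e > 0" "\<And>y. \<bar>y - x\<bar> < e \<Longrightarrow> \<bar>F y - x\<bar> < P / 2"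
  proof -
    have "isCont F x" using increasing_surj_continuous[OF SS] by (simp add: continuous_on_eq_continuous_at)
    then show ?thesis using that A.P_pos ux(3) unfolding continuous_at_eps_delta
      by (metis dist_real_def half_gt_zero)
  qed
  obtain c d where cd: "(c, d) \<in> L" "c < x" "x < d" "u < c" "d < v" "x - e < c" "d < x + e"
    "x - P / 2 < c" "d < x + P / 2"
    using A.rainbow[OF xL, of "min (min (x - u) (v - x)) (min e (P / 2))"] ux e A.P_pos by auto
  have near: "\<bar>F c - x\<bar> < P / 2" "\<bar>F d - x\<bar> < P / 2" using e(2)[of c] e(2)[of d] cd by auto
  have side: "F c < x" "x < F d" using pair_autD(5)[OF F, of c x] pair_autD(5)[OF F, of x d] ux cd by auto
  have FL: "(F c, F d) \<in> L" using F cd(1) by (auto simp: pair_aut_def)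
  have moved: "F c \<noteq> c" "F d \<noteq> d" "F y \<noteq> y" "F z \<noteq> z" using arcs cd y z by (auto simp: free_arc_def)
  have "\<not> (c < F c \<and> d < F d)"
    using A.unlinked[OF cd(1) FL] side cd near by auto
  moreover have "\<not> (F c < c \<and> F d < d)"
    using A.unlinked[OF FL cd(1)] side cd near by auto
  moreover have "c < F c \<longleftrightarrow> y < F y"
    using free_arc_sign[OF SS arcs(1)] y cd by blast
  moreover have "d < F d \<longleftrightarrow> z < F z"
    using free_arc_sign[OF SS arcs(2)] z cd by blast
  ultimately show ?thesis using moved by linarith
qed

lemma opposite_signs:
  assumes F: "aut F" and arcs: "free_arc F u x" "free_arc F x v"
    and y: "u < y" "y < x" and z: "x < z" "z < v"
  shows "y < F y \<longleftrightarrow> F z < z"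
proof -
  interpret S: lifted_pair P L' L by (rule swap)
  show ?thesis
    using opposite_signs_aux[OF F arcs _ y z] S.opposite_signs_aux[OF pair_aut_swap[OF F] arcs _ y z]
      not_both_ends by blast
qed

text \<open>With a single fixed point per period, the arcs on its two sides are translates of each
  other and move in the same direction, against \<open>opposite_signs\<close>.\<close>

lemma not_single_fixed:
  assumes F: "aut F" shows "\<not> free_arc F p (p + P)"
proof
  assume arc: "free_arc F p (p + P)"
  have arc': "free_arc F (p - P) p" using free_arc_shift[OF F arc, of "-1"] by simp
  define z where "z = p + P / 2"
  have z: "p < z" "z < p + P" "p - P < z - P" "z - P < p" using A.P_pos by (auto simp: z_def)
  have "F z \<noteq> z" using arc z by (auto simp: free_arc_def)
  moreover have "z - P < F (z - P) \<longleftrightarrow> z < F z" using pair_autD(4)[OF F, of z] by simp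
  ultimately show False using opposite_signs[OF F arc' arc z(3,4,1,2)] by linarith
qed

end

section \<open>Stabilizers of a point are abelian\<close>

locale point_stabilizer = lifted_pair P L L' for P L L' +
  fixes S :: "(real \<Rightarrow> real) set" and p :: real
  assumes aut: "f \<in> S \<Longrightarrow> pair_aut P L L' f" and fixes_p: "f \<in> S \<Longrightarrow> f p = p"
    and comp: "f \<in> S \<Longrightarrow> g \<in> S \<Longrightarrow> f \<circ> g \<in> S" and inv_closed: "f \<in> S \<Longrightarrow> inv_map f \<in> S"
    and countable: "f \<in> S \<Longrightarrow> f \<noteq> id \<Longrightarrow> countable {x. f x = x}"
begin

lemma nontrivial_isolated:
  assumes f: "f \<in> S" "f \<noteq> id" and x: "f x = x"
  shows "isolated f x"
proof (cases "three_fixed P f")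
  case True
  then show ?thesis using all_isolated[OF aut[OF f(1)] _ countable[OF f] x] by blast
next
  case False
  then have two: "y \<le> x \<or> z \<le> y \<or> x + P \<le> z" if "f y = y" "f z = z" for y z
    using that x unfolding three_fixed_def by (meson not_le)
  note pm = fixed_pm[OF aut[OF f(1)]]
  have fixed: "f x = x" "f (x + P) = x + P" "f (x - P) = x - P" using x pm by auto
  show ?thesis
  proof (cases "\<exists>q. x < q \<and> q < x + P \<and> f q = q")
    case True
    then obtain q where q: "x < q" "q < x + P" "f q = q" by blast
    have "free_arc f x q" using two[of _ q] q x by (force simp: free_arc_def)
    moreover have "free_arc f (q - P) x"
      unfolding free_arc_def
    proof (intro conjI allI impI notI)
      fix y assume y: "q - P < y \<and> y < x" "f y = y"
      then have "f (y + P) = y + P" using pm(1) by simp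
      then show False using two[OF q(3), of "y + P"] q y by linarith
    qed (use q x pm in auto)
    ultimately show ?thesis unfolding isolated_def by blast
  next
    case False
    then have arc: "free_arc f x (x + P)" using x pm A.P_pos by (auto simp: free_arc_def)
    then show ?thesis using not_single_fixed[OF aut[OF f(1)]] by blast
  qed
qed

text \<open>\<open>opposite_signs\<close> turns a single fixed point into an attracting or repelling
  one, as the ordered group argument requires.\<close>

lemma commute_on_interval:
  assumes ab: "a < b" and fixed: "\<And>f. f \<in> S \<Longrightarrow> f a = a" "\<And>f. f \<in> S \<Longrightarrow> f b = b"
    and one: "\<And>f. f \<in> S \<Longrightarrow> f \<noteq> id \<Longrightarrow> \<exists>e. free_arc f a e \<and> free_arc f e b"
    and gh: "g \<in> S" "h \<in> S"
  shows "g \<circ> h = h \<circ> g"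
proof -
  interpret one_fixed_point_action S a b
  proof unfold_locales
    fix f assume f: "f \<in> S" "f \<noteq> id"
    note F = aut[OF f(1)]
    obtain e where e: "free_arc f a e" "free_arc f e b" using one[OF f] by blast
    have ae: "a < e" "e < b" using e by (auto simp: free_arc_def)
    define y where "y = (a + e) / 2"
    define z where "z = (e + b) / 2"
    have y: "a < y" "y < e" and z: "e < z" "z < b" using ae by (auto simp: y_def z_def)
    have opp: "x < f x \<longleftrightarrow> f w < w" if "a < x" "x < e" "e < w" "w < b" for x w
      using opposite_signs[OF F e that] .
    have ne: "f x \<noteq> x" if "a < x" "x < b" "x \<noteq> e" for x
      using e that unfolding free_arc_def by (metis linorder_neqE_linordered_idom)
    show "\<exists>e. a < e \<and> e < b \<and>
       ((\<forall>x. a < x \<and> x < e \<longrightarrow> f x < x) \<and> (\<forall>x. e < x \<and> x < b \<longrightarrow> x < f x) \<or>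
        (\<forall>x. a < x \<and> x < e \<longrightarrow> x < f x) \<and> (\<forall>x. e < x \<and> x < b \<longrightarrow> f x < x))"
    proof (rule exI[of _ e], intro conjI ae)
      show "(\<forall>x. a < x \<and> x < e \<longrightarrow> f x < x) \<and> (\<forall>x. e < x \<and> x < b \<longrightarrow> x < f x) \<or>
        (\<forall>x. a < x \<and> x < e \<longrightarrow> x < f x) \<and> (\<forall>x. e < x \<and> x < b \<longrightarrow> f x < x)"
      proof (cases "y < f y")
        case True
        then have "f w < w" if "e < w" "w < b" for w using opp[OF y that] by simp
        moreover from this have "x < f x" if "a < x" "x < e" for x using opp[OF that z] z by simp
        ultimately show ?thesis by blast
      next
        case False
        then have up: "w < f w" if "e < w" "w < b" for w using opp[OF y that] ne[of w] that ae by simp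
        moreover have "f x < x" if "a < x" "x < e" for x
          using opp[OF that z] up[OF z] ne[of x] that ae by simp
        ultimately show ?thesis by blast
      qed
    qed
  qed (use ab fixed comp inv_closed pair_autD(1,2)[OF aut] in auto)
  show ?thesis using commute gh .
qed

text \<open>Otherwise the \<open>f\<close>-orbit of \<open>x\<close> would consist of fixed points
  of \<open>g\<close> and converge strictly monotonically to a fixed point of \<open>g\<close>,
  which is isolated.\<close>

lemma commuting_fixed_points:
  assumes f: "f \<in> S" and g: "g \<in> S" "g \<noteq> id" and fg: "f \<circ> g = g \<circ> f" and x: "g x = x"
  shows "f x = x"
proof (rule ccontr)
  assume nx: "f x \<noteq> x"
  note F = aut[OF f]
  note SG = pair_autD(1,2)[OF aut[OF g(1)]]
  have orbit: "g ((f ^^ n) x) = (f ^^ n) x" for n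
  proof (induction n)
    case (Suc n)
    have "g (f ((f ^^ n) x)) = f (g ((f ^^ n) x))" using fg by (metis comp_apply)
    then show ?case using Suc by simp
  qed (use x in simp)
  obtain k where k: "p \<le> x + of_int k * P" "x + of_int k * P < p + P"
    using representative[OF A.P_pos] .
  \<comment> \<open>The translate of \<open>p\<close> that starts the period containing
    \<open>x\<close>; the fixed points \<open>a\<close> and \<open>a + P\<close> of \<open>f\<close>
    bound the orbit.\<close>
  define a where "a = p + of_int (-k) * P"
  have a: "f a = a" "f (a + P) = a + P" "a \<le> x" "x \<le> a + P"
    using fixed_shift[OF F fixes_p[OF f], of "-k"] fixed_pm(1)[OF F, of a] k by (auto simp: a_def)
  consider "x < f x" | "f x < x" using nx by linarith
  then show False
  proof cases
    case 1
    obtain y where y: "(\<lambda>n. (f ^^ n) x) \<longlonglongrightarrow> y" "\<And>n. (f ^^ n) x < y"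
      using iterate_converges_up[OF pair_autD(1,2)[OF F] a(2,4) 1] by blast
    have "g y = y" using fixed_closed[OF SG y(1) orbit] .
    then obtain u where u: "free_arc g u y" using nontrivial_isolated[OF g] unfolding isolated_def by blast
    then have "u < y" by (simp add: free_arc_def)
    from order_tendstoD(1)[OF y(1) this] obtain n where "u < (f ^^ n) x"
      unfolding eventually_sequentially by blast
    then show False using free_arc_fixed[OF u orbit[of n]] y(2)[of n] by linarith
  next
    case 2
    obtain y where y: "(\<lambda>n. (f ^^ n) x) \<longlonglongrightarrow> y" "\<And>n. y < (f ^^ n) x"
      using iterate_converges_down[OF pair_autD(1,2)[OF F] a(1,3) 2] by blast
    have "g y = y" using fixed_closed[OF SG y(1) orbit] .
    then obtain v where v: "free_arc g y v" using nontrivial_isolated[OF g] unfolding isolated_def by blast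
    then have "y < v" by (simp add: free_arc_def)
    from order_tendstoD(2)[OF y(1) this] obtain n where "(f ^^ n) x < v"
      unfolding eventually_sequentially by blast
    then show False using free_arc_fixed[OF v orbit[of n]] y(2)[of n] by linarith
  qed
qed

text \<open>Besides \<open>p\<close> there is exactly one fixed point per period: at least one by
  \<open>not_single_fixed\<close>, at most one by assumption. So the interval is the whole period
  from \<open>p\<close>.\<close>

lemma commute_two_fixed:
  assumes no3: "\<And>f. f \<in> S \<Longrightarrow> f \<noteq> id \<Longrightarrow> \<not> three_fixed P f" and gh: "g \<in> S" "h \<in> S"
  shows "g \<circ> h = h \<circ> g"
proof (rule commute_on_interval[OF _ _ _ _ gh])
  show "p < p + P" using A.P_pos by simp
  show "f p = p" "f (p + P) = p + P" if "f \<in> S" for f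
    using fixes_p[OF that] fixed_pm(1)[OF aut[OF that]] by auto
  show "\<exists>e. free_arc f p e \<and> free_arc f e (p + P)" if f: "f \<in> S" "f \<noteq> id" for f
  proof -
    note F = aut[OF f(1)]
    have fixed: "f p = p" "f (p + P) = p + P" using fixes_p[OF f(1)] fixed_pm(1)[OF F] by auto
    obtain q where q: "p < q" "q < p + P" "f q = q"
      using not_single_fixed[OF F, of p] fixed A.P_pos unfolding free_arc_def by auto
    have two: "\<not> (p < y \<and> y < z \<and> z < p + P)" if "f y = y" "f z = z" for y z
      using no3[OF f] that fixed unfolding three_fixed_def by blast
    have "free_arc f p q" "free_arc f q (p + P)"
      using two[of _ q] two[of q] q fixed unfolding free_arc_def by auto
    then show ?thesis by blast
  qed
qed

text \<open>If some \<open>f0\<close> has at least three fixed points then \<open>L'\<close> has a leaf at \<open>p\<close>. There are at most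
  two, hence \<open>S\<close> fixes the other endpoint \<open>b\<close> of the first one, and every nontrivial element
  has exactly one fixed point in \<open>(p, b)\<close>.\<close>

lemma commute_three_fixed:
  assumes pL: "p \<notin> fst ` L" and f0: "f0 \<in> S" "f0 \<noteq> id" "three_fixed P f0" and gh: "g \<in> S" "h \<in> S"
  shows "g \<circ> h = h \<circ> g"
proof -
  interpret W: lifted_pair P L' L by (rule swap)
  \<comment> \<open>\<open>L\<close> joins the two neighbours of \<open>p\<close>, so the right
    neighbour \<open>v\<close> is not an endpoint of \<open>L'\<close>; hence \<open>L'\<close>
    joins the neighbours of \<open>v\<close>, namely \<open>p\<close> and \<open>v2\<close>.\<close>
  have nbrs: "\<exists>v v2. free_arc f p v \<and> free_arc f v v2 \<and> (p, v2) \<in> L' \<and> v \<notin> fst ` L'"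
    if f: "f \<in> S" "f \<noteq> id" "three_fixed P f" for f
  proof -
    note F = aut[OF f(1)]
    obtain v where v: "free_arc f p v"
      using nontrivial_isolated[OF f(1,2) fixes_p[OF f(1)]] by (auto simp: isolated_def)
    obtain u where "free_arc f u p" "(u, v) \<in> L" using next_leaf[OF F f(3) pL v] .
    then have "(v, u + P) \<in> L" using A.rotate by blast
    then have vL: "v \<notin> fst ` L'" using disjoint fst_L' by blast
    obtain v2 where "free_arc f v v2" "(p, v2) \<in> L'"
      using W.prev_leaf[OF pair_aut_swap[OF F] f(3) vL v] .
    then show ?thesis using v vL by blast
  qed
  obtain v0 v2 where v0: "free_arc f0 p v0" "free_arc f0 v0 v2" "(p, v2) \<in> L'" "v0 \<notin> fst ` L'"
    using nbrs[OF f0] by blast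
  \<comment> \<open>A leaf at \<open>p\<close> whose other end precedes \<open>v2\<close> is the
    first one, since a third leaf at \<open>p\<close> is impossible.\<close>
  obtain b where b: "(p, b) \<in> L'" "\<And>t. (p, t) \<in> L' \<Longrightarrow> b \<le> t"
  proof (cases "\<exists>t. (p, t) \<in> L' \<and> t < v2")
    case True
    then obtain t where t: "(p, t) \<in> L'" "t < v2" by blast
    have "t \<le> t'" if "(p, t') \<in> L'" for t'
      using B.not_three_leaves[OF that t(1) v0(3)] t(2) by (meson not_le)
    then show ?thesis using that t by blast
  next
    case False
    then show ?thesis using that v0(3) by (meson not_less)
  qed
  have pb: "p < b" "b < p + P" using B.bounds[OF b(1)] by auto
  \<comment> \<open>Elements of \<open>S\<close> permute the leaves of \<open>L'\<close> at
    \<open>p\<close>, so neither \<open>f\<close> nor its inverse can move \<open>b\<close> below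
    itself.\<close>
  have fb: "f b = b" if f: "f \<in> S" for f
  proof (rule antisym)
    note F = aut[OF f]
    have L'f: "(p, f b) \<in> L'" if "f \<in> S" for f
      using aut[OF that] b(1) fixes_p[OF that] unfolding pair_aut_def by metis
    show "b \<le> f b" using b(2) L'f[OF f] .
    have "b \<le> inv_map f b" using b(2) L'f[OF inv_closed[OF f]] .
    then show "f b \<le> b" using pair_autD(5)[OF F, of "inv_map f b" b] pair_autD(7)[OF F, of b] by linarith
  qed
  \<comment> \<open>\<open>b\<close> is an endpoint of \<open>L'\<close> and \<open>v\<close> is
    not, so \<open>v\<close> is strictly before the fixed point \<open>b\<close>. Then
    \<open>v2\<close> is at most \<open>b\<close>, and minimality of \<open>b\<close> gives
    equality.\<close>
  have three_b: "\<exists>v. free_arc f p v \<and> free_arc f v b \<and> v \<notin> fst ` L'"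
    if f: "f \<in> S" "f \<noteq> id" "three_fixed P f" for f
  proof -
    obtain v v2 where v: "free_arc f p v" "free_arc f v v2" "(p, v2) \<in> L'" "v \<notin> fst ` L'"
      using nbrs[OF f] by blast
    have "(b, p + P) \<in> L'" using b(1) B.rotate by blast
    then have "v \<noteq> b" using v(4) fst_L' by blast
    moreover have "v \<le> b" using free_arc_fixed[OF v(1) fb[OF f(1)]] pb by simp
    ultimately have "v2 \<le> b" using free_arc_fixed[OF v(2) fb[OF f(1)]] by simp
    then have "v2 = b" using b(2)[OF v(3)] by simp
    then show ?thesis using v by blast
  qed
  \<comment> \<open>Powers of \<open>f0\<close> or its inverse stretch a leaf of \<open>L'\<close>
    around \<open>v\<close> until its ends are near \<open>p\<close> and \<open>b\<close>. An
    element without fixed points in (p, b) moves both ends in the same direction, so the stretched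
    leaf crosses its image.\<close>
  have not_free: "\<not> free_arc h p b" if h: "h \<in> S" for h
  proof
    assume arc: "free_arc h p b"
    note H = aut[OF h]
    obtain v where v: "free_arc f0 p v" "free_arc f0 v b" "v \<notin> fst ` L'" using three_b[OF f0] by blast
    have pv: "p < v" "v < b" using v by (auto simp: free_arc_def)
    obtain y z where yz: "(y, z) \<in> L'" "p < y" "y < v" "v < z" "z < b"
      using B.rainbow[OF v(3), of "min (v - p) (b - v)"] pv by auto
    obtain K where K: "aut K" "\<forall>x. K x = x \<longleftrightarrow> f0 x = x" "(\<lambda>n. (K ^^ n) z) \<longlonglongrightarrow> b" "z < K z"
      using push_up[OF aut[OF f0(1)] v(2) yz(4,5)] .
    have arcK: "free_arc K p v" "free_arc K v b" using v K(2) by (auto simp: free_arc_def)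
    have "K y \<noteq> y" using arcK(1) yz by (auto simp: free_arc_def)
    then have "K y < y" using opposite_signs[OF K(1) arcK yz(2-5)] K(4) by linarith
    then have y_lim: "(\<lambda>n. (K ^^ n) y) \<longlonglongrightarrow> p" using push_down[OF K(1) arcK(1) yz(2,3)] by blast
    define m where "m = (p + b) / 2"
    have m: "p < m" "m < b" using pb by (auto simp: m_def)
    obtain H2 where H2: "aut H2" "\<forall>x. H2 x = x \<longleftrightarrow> h x = x" "m < H2 m"
      using push_up[OF H arc m] by blast
    have arc2: "free_arc H2 p b" using arc H2(2) by (auto simp: free_arc_def)
    have up: "x < H2 x" if "p < x" "x < b" for x
      using free_arc_sign[OF pair_autD(1,2)[OF H2(1)] arc2 m H2(3) that] .
    have "H2 p = p" "H2 b = b" using arc2 by (auto simp: free_arc_def)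
    have "p < inv_map H2 m"
      using pair_autD(5)[OF H2(1), of p "inv_map H2 m"] pair_autD(7)[OF H2(1)] \<open>H2 p = p\<close> m by simp
    \<comment> \<open>The first bound keeps the image of the lower end below \<open>m\<close>, hence
      below the upper end of the stretched leaf.\<close>
    then have "eventually (\<lambda>n. (K ^^ n) y < inv_map H2 m \<and> (K ^^ n) y < m \<and> m < (K ^^ n) z) sequentially"
      using order_tendstoD(2)[OF y_lim] order_tendstoD(1)[OF K(3)] m
      by (intro eventually_conj) auto
    then obtain n where n: "(K ^^ n) y < inv_map H2 m" "(K ^^ n) y < m" "m < (K ^^ n) z"
      unfolding eventually_sequentially by blast
    have mono: "strict_mono (K ^^ n)" using iterate_strict_mono pair_autD(1)[OF K(1)] .
    have pow_fixed: "(K ^^ n) t = t" if "K t = t" for t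
      using that by (induction n) auto
    have pn: "p < (K ^^ n) y"
      using strict_monoD[OF mono yz(2)] pow_fixed[of p] arcK by (simp add: free_arc_def)
    have nb: "(K ^^ n) z < b"
      using strict_monoD[OF mono yz(5)] pow_fixed[of b] arcK by (simp add: free_arc_def)
    have leaf: "((K ^^ n) y, (K ^^ n) z) \<in> L'" using pair_aut_funpow(2)[OF K(1) yz(1)] .
    then have leaf2: "(H2 ((K ^^ n) y), H2 ((K ^^ n) z)) \<in> L'"
      using H2(1) by (simp add: pair_aut_def)
    have "H2 ((K ^^ n) y) < m"
      using pair_autD(5)[OF H2(1), of "(K ^^ n) y" "inv_map H2 m"] pair_autD(7)[OF H2(1)] n(1) by simp
    moreover have "H2 ((K ^^ n) z) < b"
      using pair_autD(5)[OF H2(1), of "(K ^^ n) z" b] \<open>H2 b = b\<close> nb by simp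
    ultimately show False
      using B.unlinked[OF leaf leaf2] up[of "(K ^^ n) y"] up[of "(K ^^ n) z"] pn nb n m pb by linarith
  qed
  show ?thesis
  proof (rule commute_on_interval[OF pb(1) _ _ _ gh])
    show "f p = p" "f b = b" if "f \<in> S" for f using fixes_p fb that by blast+
    show "\<exists>e. free_arc f p e \<and> free_arc f e b" if f: "f \<in> S" "f \<noteq> id" for f
    proof (cases "three_fixed P f")
      case True
      then show ?thesis using three_b[OF f] by blast
    next
      case False
      have fp: "f p = p" "f b = b" using fixes_p fb f by auto
      \<comment> \<open>A fixed point between \<open>p\<close> and \<open>b\<close> would be a third
        one in the period, so \<open>f\<close> would be free on (p, b), which
        \<open>not_free\<close> excludes.\<close>
      have "f x \<noteq> x" if "p < x" "x < b" for x
        using False that fp pb unfolding three_fixed_def by blast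
      then have "free_arc f p b" using fp pb by (auto simp: free_arc_def)
      then show ?thesis using not_free f by blast
    qed
  qed
qed

lemma swap_stabilizer: "point_stabilizer P L' L S p"
proof -
  interpret W: lifted_pair P L' L by (rule swap)
  show ?thesis
    by unfold_locales (use aut pair_aut_swap fixes_p comp inv_closed countable in auto)
qed

lemma commute:
  assumes gh: "g \<in> S" "h \<in> S" shows "g \<circ> h = h \<circ> g"
proof (cases "\<exists>f\<in>S. f \<noteq> id \<and> three_fixed P f")
  case True
  interpret W: point_stabilizer P L' L S p by (rule swap_stabilizer)
  show ?thesis
    using True commute_three_fixed[OF _ _ _ _ gh] W.commute_three_fixed[OF _ _ _ _ gh] not_both_ends
    by blast
next
  case False
  then show ?thesis using commute_two_fixed[OF _ gh] by blast
qed

theorem fixed_points_eq: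
  assumes "g \<in> S" "g \<noteq> id" "h \<in> S" "h \<noteq> id"
  shows "{x. g x = x} = {x. h x = x}"
  using commuting_fixed_points[OF assms(1,3,4)] commuting_fixed_points[OF assms(3,1,2)]
    commute[OF assms(1,3)] by auto

end

section \<open>Lifting laminations of the circle\<close>

definition lift :: "complex set set \<Rightarrow> (real \<times> real) set"
  where "lift \<Lambda> = {(s, t). s < t \<and> t < s + 2 * pi \<and> {cis s, cis t} \<in> \<Lambda>}"

lemma cis_shift: "cis (x + of_int k * (2 * pi)) = cis x"
proof -
  have "cis (of_int k * (2 * pi)) = 1"
    using cis_multiple_2pi[of "of_int k"] by (simp add: mult.commute mult.left_commute)
  then show ?thesis by (simp add: cis_mult[symmetric])
qed

lemma circle_angle:
  assumes "z \<in> circle"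
  obtains y where "x \<le> y" "y < x + 2 * pi" "z = cis y"
proof -
  have "z \<noteq> 0" using assms by auto
  then have z: "z = cis (Arg z)" using assms cis_Arg[of z] by (simp add: sgn_div_norm)
  obtain k where k: "x \<le> Arg z + of_int k * (2 * pi)" "Arg z + of_int k * (2 * pi) < x + 2 * pi"
    using representative[of "2 * pi" x "Arg z"] by auto
  show ?thesis using that[OF k] z cis_shift by metis
qed

text \<open>An affine function vanishing on the chord from \<open>cis s\<close> to \<open>cis t\<close>.\<close>

definition side :: "real \<Rightarrow> real \<Rightarrow> complex \<Rightarrow> real"
  where "side s t z = Re (z * cnj (cis ((s + t) / 2))) - cos ((t - s) / 2)"

text \<open>The product form shows the signs: positive on the arc from \<open>s\<close> to
  \<open>t\<close>, negative on the complementary arc.\<close>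

lemma side_cis: "side s t (cis x) = 2 * sin ((x - s) / 2) * sin ((t - x) / 2)"
proof -
  have e: "(x - s) / 2 - (t - x) / 2 = x - (s + t) / 2" "(x - s) / 2 + (t - x) / 2 = (t - s) / 2"
    by (simp_all add: field_simps)
  have "side s t (cis x) = cos (x - (s + t) / 2) - cos ((t - s) / 2)"
    by (simp add: side_def cis_cnj cis_mult)
  also have "\<dots> = 2 * sin ((x - s) / 2) * sin ((t - x) / 2)"
    using sin_times_sin[of "(x - s) / 2" "(t - x) / 2"] unfolding e by simp
  finally show ?thesis .
qed

lemma side_pos: "s < x \<Longrightarrow> x < t \<Longrightarrow> t \<le> s + 2 * pi \<Longrightarrow> side s t (cis x) > 0"
  unfolding side_cis by (intro mult_pos_pos) (auto intro!: sin_gt_zero)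

lemma side_neg: "t < x \<Longrightarrow> x < s + 2 * pi \<Longrightarrow> s < t \<Longrightarrow> side s t (cis x) < 0"
proof -
  assume a: "t < x" "x < s + 2 * pi" "s < t"
  have "sin ((x - s) / 2) > 0" "sin ((x - t) / 2) > 0"
    using a by (auto intro!: sin_gt_zero)
  moreover have "sin ((t - x) / 2) = - sin ((x - t) / 2)"
    by (metis minus_diff_eq minus_divide_left sin_minus)
  ultimately show ?thesis unfolding side_cis by (simp add: mult_pos_pos)
qed

lemma side_ends: "side s t (cis s) = 0" "side s t (cis t) = 0"
  by (simp_all add: side_cis)

lemma side_zero_ends:
  assumes "s < t" "t < s + 2 * pi" "z \<in> circle" "side s t z = 0"
  shows "z = cis s \<or> z = cis t"
proof -
  obtain x where x: "s \<le> x" "x < s + 2 * pi" "z = cis x" using circle_angle[OF assms(3)] .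
  then have "\<not> (s < x \<and> x < t)" "\<not> t < x"
    using side_pos[of s x t] side_neg[of t x s] assms by auto
  then show ?thesis using x by force
qed

lemma cis_distinct:
  assumes "s < t" "t < s + 2 * pi" shows "cis s \<noteq> cis t"
proof
  assume "cis s = cis t"
  then have "side s ((s + t) / 2) (cis t) = 0" by (metis side_ends(1))
  moreover have "side s ((s + t) / 2) (cis t) < 0" by (rule side_neg) (use assms in \<open>auto simp: field_simps\<close>)
  ultimately show False by simp
qed

lemma side_affine: "side s t ((1 - u) *\<^sub>R a + u *\<^sub>R b) = (1 - u) * side s t a + u * side s t b"
  by (simp add: side_def algebra_simps)

lemma continuous_side: "continuous_on A (side s t)"
  unfolding side_def by (intro continuous_intros)

lemma convex_side: "convex {z. side s t z \<le> 0}"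
  unfolding convex_alt
proof (intro ballI allI impI)
  fix x y u assume "x \<in> {z. side s t z \<le> 0}" "y \<in> {z. side s t z \<le> 0}" "0 \<le> u \<and> u \<le> (1::real)"
  then have "(1 - u) * side s t x \<le> 0" "u * side s t y \<le> 0"
    by (simp_all add: mult_nonneg_nonpos)
  then show "(1 - u) *\<^sub>R x + u *\<^sub>R y \<in> {z. side s t z \<le> 0}" by (simp add: side_affine)
qed

lemma connected_side:
  assumes "connected C" "\<And>z. z \<in> C \<Longrightarrow> side s t z \<noteq> 0"
  shows "(\<forall>z\<in>C. side s t z > 0) \<or> (\<forall>z\<in>C. side s t z < 0)"
proof (rule ccontr)
  assume "\<not> ?thesis"
  then obtain y z where yz: "y \<in> C" "z \<in> C" "side s t y < 0" "side s t z > 0"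
    using assms(2) by (meson linorder_neqE_linordered_idom)
  have "connected (side s t ` C)" by (rule connected_continuous_image[OF continuous_side assms(1)])
  then have "0 \<in> side s t ` C"
    by (rule connectedD_interval[of _ "side s t y" "side s t z"]) (use yz in auto)
  then show False using assms(2) by force
qed

lemma closure_side:
  assumes "connected C" "\<And>z. z \<in> C \<Longrightarrow> side s t z \<noteq> 0"
  shows "(\<forall>z\<in>closure C. side s t z \<ge> 0) \<or> (\<forall>z\<in>closure C. side s t z \<le> 0)"
  using connected_side[OF assms]
proof
  assume "\<forall>z\<in>C. side s t z > 0"
  then have "C \<subseteq> {z. 0 \<le> side s t z}" by auto
  moreover have "closed {z. 0 \<le> side s t z}" by (intro closed_Collect_le continuous_side continuous_intros)
  ultimately show ?thesis using closure_minimal by blast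
next
  assume "\<forall>z\<in>C. side s t z < 0"
  then have "C \<subseteq> {z. side s t z \<le> 0}" by auto
  moreover have "closed {z. side s t z \<le> 0}" by (intro closed_Collect_le continuous_side continuous_intros)
  ultimately show ?thesis using closure_minimal by blast
qed

lemma side_geodesic:
  assumes st: "s < t" "t < s + 2 * pi" and z: "norm z < 1"
  shows "z \<in> geodesic {cis s, cis t} \<longleftrightarrow> side s t z = 0"
proof
  assume "z \<in> geodesic {cis s, cis t}"
  then have "z \<in> closed_segment (cis s) (cis t)" by (simp add: geodesic_def segment_convex_hull)
  then obtain u where "z = (1 - u) *\<^sub>R cis s + u *\<^sub>R cis t" by (auto simp: closed_segment_def)
  then show "side s t z = 0" by (simp add: side_affine side_ends)
next
  assume 0: "side s t z = 0"
  \<comment> \<open>Rotation by the middle angle \<open>m\<close> makes the chord vertical, at real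
    part \<open>cos h\<close>. The disk condition then bounds the imaginary part by
    \<open>sin h\<close>, and \<open>u\<close> below is its affine parameter.\<close>
  define h m where "h = (t - s) / 2" and "m = (s + t) / 2"
  define w where "w = z * cnj (cis m)"
  have h: "0 < h" "h < pi" using st by (auto simp: h_def)
  then have sh: "sin h > 0" by (rule sin_gt_zero)
  have zw: "z = cis m * w" by (simp add: w_def cis_cnj cis_mult mult.left_commute[of "cis m"])
  have Rew: "Re w = cos h" using 0 by (simp add: side_def w_def h_def m_def)
  have "norm w < 1" using z by (simp add: w_def norm_mult)
  then have "(Re w)\<^sup>2 + (Im w)\<^sup>2 < 1" by (simp add: cmod_def)
  then have "(Im w)\<^sup>2 < (sin h)\<^sup>2" using sin_cos_squared_add[of h] unfolding Rew by linarith
  then have im: "\<bar>Im w\<bar> < sin h" using sh by (metis abs_le_square_iff abs_of_pos not_le)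
  define u where "u = (Im w / sin h + 1) / 2"
  have u: "0 \<le> u" "u \<le> 1" using im sh by (auto simp: u_def field_simps abs_less_iff)
  have "w = (1 - u) *\<^sub>R cis (- h) + u *\<^sub>R cis h"
  proof (rule complex_eqI)
    show "Re w = Re ((1 - u) *\<^sub>R cis (- h) + u *\<^sub>R cis h)" by (simp add: Rew algebra_simps)
    show "Im w = Im ((1 - u) *\<^sub>R cis (- h) + u *\<^sub>R cis h)" using sh by (simp add: u_def field_simps)
  qed
  then have "z = (1 - u) *\<^sub>R (cis m * cis (- h)) + u *\<^sub>R (cis m * cis h)"
    unfolding zw by (simp add: distrib_left)
  moreover have "m + - h = s" "m + h = t" by (simp_all add: m_def h_def field_simps)
  ultimately have "z = (1 - u) *\<^sub>R cis s + u *\<^sub>R cis t" by (simp only: cis_mult)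
  then have "z \<in> closed_segment (cis s) (cis t)" using u by (auto simp: closed_segment_def)
  then show "z \<in> geodesic {cis s, cis t}" using z by (simp add: geodesic_def segment_convex_hull)
qed

lemma pairs_angles:
  assumes "l \<in> pairs"
  obtains s t where "s < t" "t < s + 2 * pi" "l = {cis s, cis t}"
proof -
  obtain x y where xy: "l = {x, y}" "x \<in> circle" "y \<in> circle" "x \<noteq> y"
    using assms by (auto simp: pairs_def)
  obtain s where s: "x = cis s" using circle_angle[OF xy(2), of 0] by blast
  obtain t where t: "s \<le> t" "t < s + 2 * pi" "y = cis t" using circle_angle[OF xy(3)] .
  then have "s < t" using xy s by (cases "s = t") auto
  then show ?thesis using that s t xy by blast
qed

text \<open>The sign of \<open>side s t\<close> separates the two open arcs, so a connected set
  avoiding their ends lies in one of them; the arcs are therefore the components.\<close>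

lemma crossing_linked:
  assumes o: "s < s'" "s' < t" "t < t'" "t' < s + 2 * pi"
  shows "linked {cis s, cis t} {cis s', cis t'}"
  unfolding linked_def
proof
  fix C assume C: "C \<in> components (circle - {cis s, cis t})"
  have st: "s < t" "t < s + 2 * pi" using o by auto
  define A where "A = cis ` {s<..<t}"
  define B where "B = cis ` {t<..<s + 2 * pi}"
  have con: "connected A" "connected B"
    unfolding A_def B_def by (intro connected_continuous_image continuous_intros; simp)+
  have Apos: "side s t z > 0" if "z \<in> A" for z using that side_pos[of s _ t] st by (auto simp: A_def)
  have Bneg: "side s t z < 0" if "z \<in> B" for z using that side_neg[of t _ s] st by (auto simp: B_def)
  have AB: "circle - {cis s, cis t} = A \<union> B"
  proof
    show "circle - {cis s, cis t} \<subseteq> A \<union> B"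
    proof
      fix z assume z: "z \<in> circle - {cis s, cis t}"
      then obtain x where x: "s \<le> x" "x < s + 2 * pi" "z = cis x" using circle_angle[of z s] by blast
      have "x \<noteq> s" "x \<noteq> t" using z x by auto
      then have "x \<in> {s<..<t} \<or> x \<in> {t<..<s + 2 * pi}" using x by auto
      then show "z \<in> A \<union> B" using x(3) by (auto simp: A_def B_def)
    qed
    have "z \<noteq> cis s \<and> z \<noteq> cis t" if "z \<in> A \<union> B" for z
      using that Apos[of z] Bneg[of z] side_ends[of s t] by auto
    then show "A \<union> B \<subseteq> circle - {cis s, cis t}" by (auto simp: A_def B_def)
  qed
  have Cc: "connected C" "C \<noteq> {}" "C \<subseteq> A \<union> B"
    using C in_components_connected in_components_nonempty in_components_subset AB by metis+
  have m: "cis s' \<in> A" "cis t' \<in> B" using o by (auto simp: A_def B_def)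
  then have m': "cis s' \<notin> B" "cis t' \<notin> A" using Apos Bneg by (meson less_asym)+
  have "\<forall>z\<in>C. side s t z \<noteq> 0" using Cc Apos Bneg by (metis Un_iff less_irrefl subsetD)
  then consider "\<forall>z\<in>C. side s t z > 0" | "\<forall>z\<in>C. side s t z < 0" using connected_side[OF Cc(1)] by blast
  then show "card (C \<inter> {cis s', cis t'}) = 1"
  proof cases
    case 1
    then have "C \<subseteq> A" using Cc Bneg by (meson UnE less_asym subsetD subsetI)
    then have "A \<subseteq> C" using components_maximal[OF C con(1)] AB Cc by blast
    then have "C \<inter> {cis s', cis t'} = {cis s'}" using \<open>C \<subseteq> A\<close> m m' by blast
    then show ?thesis by simp
  next
    case 2
    then have "C \<subseteq> B" using Cc Apos by (meson UnE less_asym subsetD subsetI)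
    then have "B \<subseteq> C" using components_maximal[OF C con(2)] AB Cc by blast
    then have "C \<inter> {cis s', cis t'} = {cis t'}" using \<open>C \<subseteq> B\<close> m m' by blast
    then show ?thesis by simp
  qed
qed

section \<open>Limits of leaves and the geometry of gaps\<close>

lemma leaf_circle:
  assumes "lamination \<Lambda>" "{a, b} \<in> \<Lambda>"
  shows "a \<in> circle" "b \<in> circle" "a \<noteq> b"
proof -
  have "{a, b} \<in> pairs" using assms by (auto simp: lamination_def)
  then show "a \<in> circle" "b \<in> circle" "a \<noteq> b"
    by (auto simp: pairs_def doubleton_eq_iff)
qed

lemma leaf_pair: "lamination \<Lambda> \<Longrightarrow> l \<in> \<Lambda> \<Longrightarrow> \<exists>a b. l = {a, b}"
  unfolding lamination_def pairs_def by blast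

lemma leaf_limit:
  assumes \<Lambda>: "lamination \<Lambda>" and leaf: "\<And>n. {a n, b n} \<in> \<Lambda>"
    and lim: "a \<longlonglongrightarrow> a'" "b \<longlonglongrightarrow> b'" "a' \<noteq> b'"
  shows "{a', b'} \<in> \<Lambda>"
proof -
  let ?U = "circle \<times> circle - Id :: (complex \<times> complex) set"
  let ?T = "{(x, y) \<in> ?U. {x, y} \<in> \<Lambda>}"
  have "closedin (top_of_set ?U) ?T" using \<Lambda> by (simp add: lamination_def)
  then obtain T where T: "closed T" "?T = ?U \<inter> T" by (auto simp: closedin_closed)
  have ab: "a n \<in> circle" "b n \<in> circle" "a n \<noteq> b n" for n using leaf_circle[OF \<Lambda> leaf] by auto
  have "(a n, b n) \<in> ?T" for n using ab leaf by auto
  then have "(a n, b n) \<in> T" for n using T by blast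
  moreover have "(\<lambda>n. (a n, b n)) \<longlonglongrightarrow> (a', b')" using lim by (intro tendsto_Pair)
  ultimately have "(a', b') \<in> T" by (rule closed_sequentially[OF T(1)])
  moreover have "a' \<in> circle" "b' \<in> circle"
    using closed_sequentially[OF closed_sphere ab(1) lim(1)] closed_sequentially[OF closed_sphere ab(2) lim(2)]
    by blast+
  ultimately have "(a', b') \<in> ?T" using T lim(3) by blast
  then show ?thesis by simp
qed

text \<open>By strict convexity, every point of the circle is extreme in the disk, hence extreme in
  each convex subset of the disk containing it.\<close>

lemma circle_vertex:
  assumes "V \<subseteq> circle" "z \<in> circle" "z \<in> convex hull V"
  shows "z \<in> V"
proof (rule extreme_point_of_convex_hull)
  have "convex hull V \<subseteq> cball 0 1" using assms(1) by (intro hull_minimal) auto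
  moreover have "z extreme_point_of cball 0 1"
    unfolding extreme_point_of_def using assms(2) dist_decreases_open_segment[of z _ _ 0] by fastforce
  ultimately show "z extreme_point_of convex hull V"
    using assms(3) unfolding extreme_point_of_def by blast
qed

text \<open>Compactness is applied to both ends and the affine parameter together. The limit chord
  may degenerate to a single point; each use treats that case separately.\<close>

lemma chord_limit:
  assumes \<Lambda>: "lamination \<Lambda>" and leaf: "\<And>n. {a n, b n} \<in> \<Lambda>"
    and q: "\<And>n. q n \<in> convex hull {a n, b n}" "q \<longlonglongrightarrow> q'"
  obtains a' b' r where "strict_mono r" "(\<lambda>n. a (r n)) \<longlonglongrightarrow> a'" "(\<lambda>n. b (r n)) \<longlonglongrightarrow> b'"
    "a' \<in> circle" "b' \<in> circle" "q' \<in> convex hull {a', b'}"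
proof -
  have "\<exists>u. 0 \<le> u \<and> u \<le> 1 \<and> q n = (1 - u) *\<^sub>R a n + u *\<^sub>R b n" for n
    using q(1)[of n] by (auto simp: segment_convex_hull[symmetric] closed_segment_def)
  then obtain u where u: "\<And>n. 0 \<le> u n" "\<And>n. u n \<le> 1" "\<And>n. q n = (1 - u n) *\<^sub>R a n + u n *\<^sub>R b n"
    by metis
  let ?K = "circle \<times> circle \<times> {0..1::real}"
  have "compact ?K" by (intro compact_Times) auto
  moreover have "\<forall>n. (a n, b n, u n) \<in> ?K" using leaf_circle[OF \<Lambda> leaf] u by auto
  ultimately obtain l r where lr: "l \<in> ?K" "strict_mono r" "((\<lambda>n. (a n, b n, u n)) \<circ> r) \<longlonglongrightarrow> l"
    unfolding compact_def by meson
  obtain a' b' u' where l: "l = (a', b', u')" by (cases l)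
  have lim: "(\<lambda>n. a (r n)) \<longlonglongrightarrow> a'" "(\<lambda>n. b (r n)) \<longlonglongrightarrow> b'" "(\<lambda>n. u (r n)) \<longlonglongrightarrow> u'"
    using tendsto_fst[OF lr(3)] tendsto_fst[OF tendsto_snd[OF lr(3)]] tendsto_snd[OF tendsto_snd[OF lr(3)]]
    by (simp_all add: l o_def)
  have "(\<lambda>n. q (r n)) \<longlonglongrightarrow> (1 - u') *\<^sub>R a' + u' *\<^sub>R b'"
    unfolding u(3) by (intro tendsto_intros lim)
  moreover have "(\<lambda>n. q (r n)) \<longlonglongrightarrow> q'"
    using LIMSEQ_subseq_LIMSEQ[OF q(2) lr(2)] by (simp add: o_def)
  ultimately have "q' = (1 - u') *\<^sub>R a' + u' *\<^sub>R b'" using LIMSEQ_unique by blast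
  then have "q' \<in> convex hull {a', b'}"
    using lr(1) l by (auto simp: segment_convex_hull[symmetric] closed_segment_def)
  then show ?thesis using that lr lim l by auto
qed

text \<open>A limit of points on leaves that stays in the open disk cannot come from chords
  shrinking to a circle point, so the limit chord is again a leaf.\<close>

lemma open_complement:
  assumes \<Lambda>: "lamination \<Lambda>"
  shows "open (hyperbolic_plane - (\<Union>l\<in>\<Lambda>. geodesic l))"
proof -
  let ?U = "\<Union>l\<in>\<Lambda>. geodesic l"
  have "closed (?U \<union> - hyperbolic_plane)"
    unfolding closed_sequential_limits
  proof (intro allI impI, elim conjE)
    fix q q' assume q: "\<forall>n. q n \<in> ?U \<union> - hyperbolic_plane" "q \<longlonglongrightarrow> q'"
    show "q' \<in> ?U \<union> - hyperbolic_plane"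
    proof (cases "q' \<in> hyperbolic_plane")
      case True
      then have "eventually (\<lambda>n. q n \<in> hyperbolic_plane) sequentially"
        using topological_tendstoD[OF q(2) open_ball] by blast
      then obtain N where N: "\<And>n. n \<ge> N \<Longrightarrow> q n \<in> hyperbolic_plane"
        unfolding eventually_sequentially by blast
      have "\<exists>a b. {a, b} \<in> \<Lambda> \<and> q (n + N) \<in> convex hull {a, b}" for n
      proof -
        obtain l where l: "l \<in> \<Lambda>" "q (n + N) \<in> convex hull l" using q(1) N[of "n + N"] by (force simp: geodesic_def)
        then obtain a b where "l = {a, b}" using leaf_pair[OF \<Lambda>] by blast
        then show ?thesis using l by blast
      qed
      then obtain a b where ab: "\<And>n. {a n, b n} \<in> \<Lambda>" "\<And>n. q (n + N) \<in> convex hull {a n, b n}" by metis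
      have "(\<lambda>n. q (n + N)) \<longlonglongrightarrow> q'" using q(2) by (rule LIMSEQ_ignore_initial_segment)
      from chord_limit[OF \<Lambda> ab this] obtain a' b' r where r: "strict_mono (r :: nat \<Rightarrow> nat)"
        "(\<lambda>n. a (r n)) \<longlonglongrightarrow> a'" "(\<lambda>n. b (r n)) \<longlonglongrightarrow> b'" "a' \<in> circle" "q' \<in> convex hull {a', b'}" by metis
      have "a' \<noteq> b'" using r(4,5) True by auto
      then have "{a', b'} \<in> \<Lambda>" using leaf_limit[OF \<Lambda> ab(1) r(2,3)] by blast
      then show ?thesis using r(5) True by (auto simp: geodesic_def)
    qed auto
  qed
  moreover have "- (?U \<union> - hyperbolic_plane) = hyperbolic_plane - ?U" by auto
  ultimately show ?thesis by (metis open_Compl)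
qed

lemma gap_component_side:
  assumes \<Lambda>: "lamination \<Lambda>" and C: "C \<in> components (hyperbolic_plane - (\<Union>l\<in>\<Lambda>. geodesic l))"
    and leaf: "s < t" "t < s + 2 * pi" "{cis s, cis t} \<in> \<Lambda>"
  shows "(\<forall>z\<in>closure C. side s t z \<ge> 0) \<or> (\<forall>z\<in>closure C. side s t z \<le> 0)"
proof (rule closure_side)
  show "connected C" using C in_components_connected by blast
  fix z assume "z \<in> C"
  then have "z \<in> hyperbolic_plane" "z \<notin> geodesic {cis s, cis t}"
    using in_components_subset[OF C] leaf(3) by auto
  then show "side s t z \<noteq> 0" using side_geodesic[OF leaf(1,2)] by simp
qed

text \<open>The outer two leaves would be edges of a common gap, but the middle leaf has their other
  ends strictly on different sides.\<close>

lemma loose_not_three_leaves: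
  assumes \<Lambda>: "lamination \<Lambda>" "loose \<Lambda>"
    and leaves: "(s, t1) \<in> lift \<Lambda>" "(s, t2) \<in> lift \<Lambda>" "(s, t3) \<in> lift \<Lambda>" and lt: "t1 < t2" "t2 < t3"
  shows False
proof -
  have L: "s < t1" "s < t2" "t2 < s + 2 * pi" "t3 < s + 2 * pi" "{cis s, cis t1} \<in> \<Lambda>"
    "{cis s, cis t2} \<in> \<Lambda>" "{cis s, cis t3} \<in> \<Lambda>" using leaves by (auto simp: lift_def)
  have "cis t1 \<noteq> cis t3" using cis_distinct[of t1 t3] L lt by auto
  then have "{cis s, cis t1} \<noteq> {cis s, cis t3}" by (auto simp: doubleton_eq_iff)
  moreover have "{cis s, cis t1} \<inter> {cis s, cis t3} \<noteq> {}" by simp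
  ultimately obtain Q where Q: "Q \<in> gaps \<Lambda>" "(convex hull {cis s, cis t1}) edge_of Q" "(convex hull {cis s, cis t3}) edge_of Q"
    using \<Lambda>(2)[unfolded loose_def, rule_format, OF L(5,7)] by auto
  obtain C where C: "C \<in> components (hyperbolic_plane - (\<Union>l\<in>\<Lambda>. geodesic l))" "Q = closure C"
    using Q(1) by (auto simp: gaps_def)
  have "convex hull {cis s, cis t1} \<subseteq> Q" "convex hull {cis s, cis t3} \<subseteq> Q"
    using Q face_of_imp_subset by (auto simp: edge_of_def)
  moreover have "cis t1 \<in> convex hull {cis s, cis t1}" "cis t3 \<in> convex hull {cis s, cis t3}"
    by (simp_all add: hull_inc)
  ultimately have "cis t1 \<in> closure C" "cis t3 \<in> closure C" using C(2) by auto
  moreover have "side s t2 (cis t1) > 0" using side_pos L lt by simp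
  moreover have "side s t2 (cis t3) < 0" using side_neg L lt by simp
  ultimately show False using gap_component_side[OF \<Lambda>(1) C(1) L(2,3,6)] by force
qed

text \<open>If the radius towards a vertex \<open>z\<close> of a gap ends in that gap, then the edge joining
  \<open>z\<close> to the next vertex is on a leaf, so \<open>z\<close> is an endpoint.\<close>

lemma gap_vertex_endpoint:
  assumes \<Lambda>: "lamination \<Lambda>" and C: "C \<in> components (hyperbolic_plane - (\<Union>l\<in>\<Lambda>. geodesic l))"
    and poly: "ideal_polygon (closure C)" and z: "z \<in> circle" "z \<in> closure C"
  shows "\<exists>l\<in>\<Lambda>. z \<in> l"
proof -
  obtain V where V: "finite V" "3 \<le> card V" "V \<subseteq> circle" "closure C = convex hull V"
    using poly by (auto simp: ideal_polygon_def)
  have zV: "z \<in> V" using circle_vertex[OF V(3) z(1)] z(2) V(4) by simp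
  obtain x where x: "z = cis x" using circle_angle[OF z(1), of 0] by blast
  \<comment> \<open>Angles of the other vertices, counted counterclockwise from \<open>z\<close>;
    the minimum \<open>t\<close> is the next vertex.\<close>
  define Y where "Y = {y. x < y \<and> y < x + 2 * pi \<and> cis y \<in> V}"
  have angle: "w = z \<or> (\<exists>y\<in>Y. w = cis y)" if "w \<in> V" for w
  proof -
    obtain y where y: "x \<le> y" "y < x + 2 * pi" "w = cis y" using circle_angle[of w x] \<open>w \<in> V\<close> V(3) by blast
    then have "y = x \<or> y \<in> Y" using \<open>w \<in> V\<close> by (auto simp: Y_def)
    then show ?thesis using y(3) x by blast
  qed
  have "inj_on cis Y"
  proof (rule inj_onI)
    fix y y' assume "y \<in> Y" "y' \<in> Y" "cis y = cis y'"
    then show "y = y'" using cis_distinct[of y y'] cis_distinct[of y' y] by (force simp: Y_def)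
  qed
  moreover have "cis ` Y \<subseteq> V" by (auto simp: Y_def)
  ultimately have finY: "finite Y" using V(1) by (meson finite_imageD finite_subset)
  have "Y \<noteq> {}"
  proof
    assume "Y = {}"
    then have "V \<subseteq> {z}" using angle by blast
    then have "card V \<le> card {z}" by (intro card_mono) auto
    then show False using V(2) by simp
  qed
  define t where "t = Min Y"
  have tY: "t \<in> Y" "\<And>y. y \<in> Y \<Longrightarrow> t \<le> y" using finY \<open>Y \<noteq> {}\<close> by (auto simp: t_def)
  have t: "x < t" "t < x + 2 * pi" "cis t \<in> V" using tY(1) by (auto simp: Y_def)
  \<comment> \<open>No vertex lies on the arc between \<open>z\<close> and the next vertex, so the
    polygon is on one side of that edge.\<close>
  have "V \<subseteq> {w. side x t w \<le> 0}"
  proof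
    fix w assume "w \<in> V"
    from angle[OF this] show "w \<in> {w. side x t w \<le> 0}"
    proof
      assume "\<exists>y\<in>Y. w = cis y"
      then obtain y where y: "y \<in> Y" "w = cis y" by blast
      then have "y = t \<or> side x t (cis y) < 0" using tY(2)[of y] side_neg[of t y x] t by (auto simp: Y_def le_less)
      then show ?thesis using y side_ends by auto
    qed (simp add: x side_ends)
  qed
  then have half: "closure C \<subseteq> {w. side x t w \<le> 0}" unfolding V(4) by (intro hull_minimal convex_side)
  \<comment> \<open>The midpoint of the edge: it lies in the disk and on the boundary of the
    gap.\<close>
  define y where "y = (1 - 1/2) *\<^sub>R cis x + (1/2) *\<^sub>R cis t"
  have y_in: "y \<in> closure C"
    unfolding V(4) y_def using zV t(3) x by (intro convexD_alt convex_convex_hull) (auto intro: hull_inc)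
  have seg: "y \<in> convex hull {cis x, cis t}"
    unfolding y_def by (intro convexD_alt convex_convex_hull) (auto intro: hull_inc)
  have y_side: "side x t y = 0" unfolding y_def side_affine by (simp add: side_ends)
  have y_disk: "norm y < 1"
  proof (rule ccontr)
    assume "\<not> norm y < 1"
    moreover have "convex hull {cis x, cis t} \<subseteq> cball 0 1" by (intro hull_minimal) auto
    ultimately have "y \<in> circle" using seg by force
    then have "y \<in> {cis x, cis t}" using circle_vertex[of "{cis x, cis t}" y] seg by auto
    then have "cis x = cis t" by (auto simp: y_def complex_eq_iff)
    then show False using cis_distinct t by blast
  qed
  have "y \<notin> C"
  proof
    assume "y \<in> C"
    moreover have "open C" using open_components[OF open_complement[OF \<Lambda>] C] .
    ultimately obtain e where e: "e > 0" "ball y e \<subseteq> C" using openE by blast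
    \<comment> \<open>A small step from \<open>y\<close> in the outward normal direction, which
      would leave the half-plane containing the gap.\<close>
    define w where "w = y + of_real (e / 2) * cis ((x + t) / 2)"
    have "dist y w < e" using e(1) by (simp add: w_def dist_norm norm_mult)
    then have "w \<in> closure C" using e(2) closure_subset[of C] by auto
    moreover have "side x t w = side x t y + e / 2"
    proof -
      have "cis ((x + t) / 2) * cnj (cis ((x + t) / 2)) = 1" by (simp add: cis_cnj cis_mult)
      then have "w * cnj (cis ((x + t) / 2)) = y * cnj (cis ((x + t) / 2)) + of_real (e / 2)"
        by (simp add: w_def distrib_right mult.assoc)
      then show ?thesis by (simp add: side_def)
    qed
    ultimately show False using half y_side e(1) by auto
  qed
  have "y \<in> (\<Union>l\<in>\<Lambda>. geodesic l)"
  proof (rule ccontr)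
    assume "\<not> ?thesis"
    then have yD: "y \<in> hyperbolic_plane - (\<Union>l\<in>\<Lambda>. geodesic l)" using y_disk by simp
    \<comment> \<open>Components are relatively closed, so a limit point of \<open>C\<close> in the
      complement of the leaves would belong to \<open>C\<close>.\<close>
    obtain T where T: "closed T" "C = (hyperbolic_plane - (\<Union>l\<in>\<Lambda>. geodesic l)) \<inter> T"
      using closedin_component[OF C] by (auto simp: closedin_closed)
    then have "closure C \<subseteq> T" by (intro closure_minimal) auto
    then show False using y_in yD T(2) \<open>y \<notin> C\<close> by blast
  qed
  then obtain l where l: "l \<in> \<Lambda>" "y \<in> geodesic l" by blast
  have "l \<in> pairs" using l \<Lambda> by (auto simp: lamination_def)
  then obtain p q where pq: "p < q" "q < p + 2 * pi" "l = {cis p, cis q}" using pairs_angles by blast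
  have 0: "side p q y = 0" using side_geodesic[OF pq(1,2) y_disk] l pq by simp
  \<comment> \<open>The leaf through \<open>y\<close> has the whole gap on one closed side. The
    values of \<open>side p q\<close> at the two ends of the edge have sum zero and the same weak
    sign, so both vanish.\<close>
  have "cis x \<in> closure C" "cis t \<in> closure C" using z x V(4) t(3) hull_inc by auto
  moreover have "side p q (cis x) + side p q (cis t) = 0"
    using 0 unfolding y_def side_affine by simp
  moreover have "(\<forall>w\<in>closure C. side p q w \<ge> 0) \<or> (\<forall>w\<in>closure C. side p q w \<le> 0)"
    by (rule gap_component_side[OF \<Lambda> C pq(1,2)]) (use l(1) pq(3) in simp)
  ultimately have "side p q (cis x) = 0" by (smt (verit) bspec)
  then have "side p q z = 0" by (simp add: x)
  then have "z \<in> l" using side_zero_ends[OF pq(1,2) z(1)] pq(3) by auto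
  then show ?thesis using l(1) by blast
qed

text \<open>Leaves meet the radius to \<open>z\<close> arbitrarily close to \<open>z\<close>;
  otherwise the end of the radius lies in one gap and \<open>gap_vertex_endpoint\<close> applies.
  The limit of these chords contains \<open>z\<close>, hence ends at \<open>z\<close>, and it would
  be a leaf at \<open>z\<close> unless both ends converge to \<open>z\<close>. Crossing the radius
  puts the ends on opposite sides of it.\<close>

lemma very_full_rainbow:
  assumes \<Lambda>: "lamination \<Lambda>" "very_full \<Lambda>" and x: "x \<notin> fst ` lift \<Lambda>" and e: "e > 0"
  shows "\<exists>c d. (c, d) \<in> lift \<Lambda> \<and> x - e < c \<and> c < x \<and> x < d \<and> d < x + e"
proof -
  let ?U = "\<Union>l\<in>\<Lambda>. geodesic l"
  define z where "z = cis x"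
  have zc: "z \<in> circle" by (simp add: z_def)
  have not_end: "z \<notin> l" if "l \<in> \<Lambda>" for l
  proof
    assume "z \<in> l"
    moreover have "l \<in> pairs" using that \<Lambda> by (auto simp: lamination_def)
    ultimately obtain w where w: "l = {z, w}" "w \<in> circle" "w \<noteq> z" by (auto simp: pairs_def)
    obtain y where y: "x \<le> y" "y < x + 2 * pi" "w = cis y" using circle_angle[OF w(2)] .
    then have "(x, y) \<in> lift \<Lambda>" using that w by (cases "y = x") (auto simp: lift_def z_def)
    then show False using x by force
  qed
  have radius: "\<exists>r. r0 < r \<and> r < 1 \<and> of_real r * z \<in> ?U" if "r0 < 1" for r0
  proof (rule ccontr)
    assume no: "\<not> ?thesis"
    define r1 where "r1 = max r0 0"
    have r1: "0 \<le> r1" "r1 < 1" "r0 \<le> r1" using that by (auto simp: r1_def)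
    define R where "R = (\<lambda>r. of_real r * z) ` {r1<..<1}"
    have conR: "connected R" unfolding R_def
      by (intro connected_continuous_image continuous_intros) simp
    have Rsub: "R \<subseteq> hyperbolic_plane - ?U"
      using no r1 by (auto simp: R_def z_def norm_mult)
    have "R \<noteq> {}" using r1 by (auto simp: R_def)
    then obtain C where C: "C \<in> components (hyperbolic_plane - ?U)" "R \<subseteq> C"
      using exists_component_superset[OF Rsub _ conR] Rsub by blast
    have "closure C \<in> gaps \<Lambda>" using C(1) by (auto simp: gaps_def)
    then have poly: "ideal_polygon (closure C)" using \<Lambda>(2) by (auto simp: very_full_def)
    have "z \<in> closure R"
    proof -
      define w where "w = (\<lambda>n. of_real (1 - (1 - r1) / (real n + 2)) * z)"
      have "w n \<in> R" for n
      proof -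
        have "(1 - r1) / (real n + 2) > 0" "(1 - r1) / (real n + 2) < 1 - r1"
          using r1 mult_strict_left_mono[of 1 "real n + 2" "1 - r1"] by (simp_all add: divide_less_eq)
        then show ?thesis unfolding w_def R_def by (intro imageI) auto
      qed
      moreover have "w \<longlonglongrightarrow> z"
      proof -
        have "(\<lambda>n. 1 - (1 - r1) / (real n + 2)) \<longlonglongrightarrow> 1" by real_asymp
        then have "w \<longlonglongrightarrow> of_real 1 * z" unfolding w_def by (intro tendsto_intros)
        then show ?thesis by simp
      qed
      ultimately show ?thesis unfolding closure_sequential by blast
    qed
    then have "z \<in> closure C" using closure_mono[OF C(2)] by blast
    then show False using gap_vertex_endpoint[OF \<Lambda>(1) C(1) poly zc] not_end by blast
  qed
  have "\<exists>r a b. 1 - 1 / (real n + 1) < r \<and> r < 1 \<and> {a, b} \<in> \<Lambda> \<and> of_real r * z \<in> convex hull {a, b}" for n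
  proof -
    have "1 - 1 / (real n + 1) < 1" by simp
    then obtain r where r: "1 - 1 / (real n + 1) < r" "r < 1" "of_real r * z \<in> ?U" using radius by blast
    then obtain l where l: "l \<in> \<Lambda>" "of_real r * z \<in> convex hull l" by (auto simp: geodesic_def)
    then obtain a b where "l = {a, b}" using leaf_pair[OF \<Lambda>(1)] by blast
    then show ?thesis using l r by blast
  qed
  then obtain r a b where r: "\<And>n. 1 - 1 / (real n + 1) < r n" "\<And>n. r n < 1"
    and ab: "\<And>n. {a n, b n} \<in> \<Lambda>" and q: "\<And>n. of_real (r n) * z \<in> convex hull {a n, b n}" by metis
  have "r \<longlonglongrightarrow> 1"
  proof (rule tendsto_sandwich)
    show "(\<lambda>n. 1 - 1 / (real n + 1)) \<longlonglongrightarrow> 1" by real_asymp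
    show "eventually (\<lambda>n. 1 - 1 / (real n + 1) \<le> r n) sequentially" "eventually (\<lambda>n. r n \<le> 1) sequentially"
      using r by (auto intro: always_eventually less_imp_le)
  qed auto
  then have "(\<lambda>n. of_real (r n) * z) \<longlonglongrightarrow> of_real 1 * z" by (intro tendsto_intros)
  then have qlim: "(\<lambda>n. of_real (r n) * z) \<longlonglongrightarrow> z" by simp
  obtain a' b' k where k: "strict_mono (k :: nat \<Rightarrow> nat)" "(\<lambda>n. a (k n)) \<longlonglongrightarrow> a'" "(\<lambda>n. b (k n)) \<longlonglongrightarrow> b'"
    "a' \<in> circle" "b' \<in> circle" "z \<in> convex hull {a', b'}"
    using chord_limit[OF \<Lambda>(1) ab q qlim] by metis
  have "z \<in> {a', b'}" using circle_vertex[OF _ zc k(6)] k(4,5) by blast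
  moreover have "a' = b'" using leaf_limit[OF \<Lambda>(1) ab k(2,3)] not_end calculation by blast
  ultimately have lim: "a' = z" "b' = z" by auto
  define \<alpha> where "\<alpha> = (\<lambda>n. Arg (a (k n) / z))"
  define \<beta> where "\<beta> = (\<lambda>n. Arg (b (k n) / z))"
  have z0: "z \<noteq> 0" by (simp add: z_def)
  have Arg_lim: "(\<lambda>n. Arg (f n / z)) \<longlonglongrightarrow> 0" if "f \<longlonglongrightarrow> z" for f
  proof -
    have "(\<lambda>n. f n / z) \<longlonglongrightarrow> z / z" using that z0 by (intro tendsto_intros)
    then have "(\<lambda>n. f n / z) \<longlonglongrightarrow> 1" using z0 by simp
    moreover have "isCont Arg 1" by (rule continuous_at_Arg) (simp add: complex_nonpos_Reals_iff)
    ultimately have "(\<lambda>n. Arg (f n / z)) \<longlonglongrightarrow> Arg 1" using isCont_tendsto_compose by blast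
    then show ?thesis by simp
  qed
  \<comment> \<open>The cap \<open>pi / 2\<close> lets the sine carry the sign of each angle and
    keeps the lifted pair within a period.\<close>
  define e' where "e' = min e (pi / 2)"
  have e': "e' > 0" "e' \<le> e" "e' \<le> pi / 2" using e by (auto simp: e'_def)
  have "eventually (\<lambda>n. \<bar>\<alpha> n\<bar> < e' \<and> \<bar>\<beta> n\<bar> < e') sequentially"
    using Arg_lim[OF k(2)[unfolded lim]] Arg_lim[OF k(3)[unfolded lim]] e'(1)
    unfolding \<alpha>_def \<beta>_def by (intro eventually_conj) (auto simp: tendsto_iff dist_real_def)
  then have "eventually (\<lambda>n. \<bar>\<alpha> n\<bar> < e' \<and> \<bar>\<beta> n\<bar> < e' \<and> n \<ge> 1) sequentially"
    using eventually_ge_at_top[of 1] by eventually_elim auto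
  then obtain n where n: "\<bar>\<alpha> n\<bar> < e'" "\<bar>\<beta> n\<bar> < e'"
    unfolding eventually_sequentially by blast
  let ?s = "\<alpha> n" and ?t = "\<beta> n"
  have cis_Arg_div: "w = cis (x + Arg (w / z))" if "w \<in> circle" for w
  proof -
    have "w / z \<noteq> 0" "norm (w / z) = 1" using that z0 by (auto simp: z_def norm_divide)
    then have "cis (Arg (w / z)) = w / z" using cis_Arg[of "w / z"] by (simp add: sgn_div_norm)
    then show ?thesis using z0 by (simp add: cis_mult[symmetric] z_def)
  qed
  have leaf: "{cis (x + ?s), cis (x + ?t)} \<in> \<Lambda>"
    using cis_Arg_div leaf_circle[OF \<Lambda>(1) ab[of "k n"]] ab[of "k n"] unfolding \<alpha>_def \<beta>_def by metis
  have "cis (x + ?s) \<noteq> z" "cis (x + ?t) \<noteq> z" using not_end[OF leaf] by auto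
  then have ne: "?s \<noteq> 0" "?t \<noteq> 0" by (auto simp: z_def)
  obtain u where u: "0 \<le> u" "u \<le> 1" "of_real (r (k n)) * z = (1 - u) *\<^sub>R cis (x + ?s) + u *\<^sub>R cis (x + ?t)"
  proof -
    have "a (k n) = cis (x + ?s)" "b (k n) = cis (x + ?t)"
      using cis_Arg_div leaf_circle[OF \<Lambda>(1) ab[of "k n"]] unfolding \<alpha>_def \<beta>_def by metis+
    then show ?thesis using q[of "k n"] that by (auto simp: segment_convex_hull[symmetric] closed_segment_def)
  qed
  have "z * of_real (r (k n)) = z * ((1 - u) *\<^sub>R cis ?s + u *\<^sub>R cis ?t)"
    using u(3) by (simp add: z_def cis_mult[symmetric] algebra_simps)
  then have "of_real (r (k n)) = (1 - u) *\<^sub>R cis ?s + u *\<^sub>R cis ?t" using z0 by (simp only: mult_cancel_left) simp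
  \<comment> \<open>Rotated so that \<open>z\<close> becomes 1, the chord meets the real axis; its
    ends cannot both be strictly above or strictly below it.\<close>
  from arg_cong[OF this, of Im] have Im0: "(1 - u) * sin ?s + u * sin ?t = 0" by simp
  have pos: "\<not> (0 < ?s \<and> 0 < ?t)"
  proof
    assume "0 < ?s \<and> 0 < ?t"
    then have "sin ?s > 0" "sin ?t > 0" using n e'(3) by (auto intro!: sin_gt_zero)
    then show False using Im0 u(1,2)
      by (smt (verit) mult_nonneg_nonneg mult_pos_pos)
  qed
  have neg: "\<not> (?s < 0 \<and> ?t < 0)"
  proof
    assume "?s < 0 \<and> ?t < 0"
    then have "sin (- ?s) > 0" "sin (- ?t) > 0" using n e'(3) by (auto intro!: sin_gt_zero simp del: sin_minus)
    then have "sin ?s < 0" "sin ?t < 0" by simp_all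
    then show False using Im0 u(1,2)
      by (smt (verit) mult_nonneg_nonpos mult_pos_neg)
  qed
  consider "?s < 0" "0 < ?t" | "?t < 0" "0 < ?s" using ne pos neg by linarith
  then show ?thesis
  proof cases
    case 1
    then have "(x + ?s, x + ?t) \<in> lift \<Lambda>" using leaf n e' by (auto simp: lift_def)
    then show ?thesis using 1 n e' by (intro exI[of _ "x + ?s"] exI[of _ "x + ?t"]) auto
  next
    case 2
    then have "(x + ?t, x + ?s) \<in> lift \<Lambda>" using leaf n e' by (auto simp: lift_def insert_commute)
    then show ?thesis using 2 n e' by (intro exI[of _ "x + ?t"] exI[of _ "x + ?s"]) auto
  qed
qed

lemma lifted_lamination_lift:
  assumes \<Lambda>: "lamination \<Lambda>" "very_full \<Lambda>" "loose \<Lambda>"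
  shows "lifted_lamination (2 * pi) (lift \<Lambda>)"
proof
  show "2 * pi > 0" by simp
  show "s < t \<and> t < s + 2 * pi" if "(s, t) \<in> lift \<Lambda>" for s t using that by (auto simp: lift_def)
  show "(s, t) \<in> lift \<Lambda> \<longleftrightarrow> (t, s + 2 * pi) \<in> lift \<Lambda>" for s t
    using cis_shift[of s 1] by (auto simp: lift_def insert_commute)
  show "(a, b) \<in> lift \<Lambda>" if "\<And>n. (X n, Y n) \<in> lift \<Lambda>" "X \<longlonglongrightarrow> a" "Y \<longlonglongrightarrow> b" "a < b" "b < a + 2 * pi" for X Y a b
  proof -
    have "{cis (X n), cis (Y n)} \<in> \<Lambda>" for n using that(1)[of n] by (simp add: lift_def)
    moreover have "(\<lambda>n. cis (X n)) \<longlonglongrightarrow> cis a" "(\<lambda>n. cis (Y n)) \<longlonglongrightarrow> cis b"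
      using that(2,3) by (intro tendsto_intros; simp)+
    ultimately have "{cis a, cis b} \<in> \<Lambda>" by (rule leaf_limit[OF \<Lambda>(1)]) (use cis_distinct that in blast)
    then show ?thesis using that by (simp add: lift_def)
  qed
  show False if "(s, t) \<in> lift \<Lambda>" "(s', t') \<in> lift \<Lambda>" "s < s'" "s' < t" "t < t'" "t' < s + 2 * pi" for s t s' t'
    using crossing_linked[OF that(3-6)] \<Lambda>(1) that(1,2) by (auto simp: lift_def lamination_def)
qed (use very_full_rainbow[OF \<Lambda>(1,2)] loose_not_three_leaves[OF \<Lambda>(1,3)] in blast)+

section \<open>Lifting homeomorphisms of the circle\<close>

definition lifts :: "(real \<Rightarrow> real) \<Rightarrow> (complex \<Rightarrow> complex) \<Rightarrow> bool"
  where "lifts F f \<longleftrightarrow> strict_mono F \<and> surj F \<and> (\<forall>x. F (x + 2 * pi) = F x + 2 * pi) \<and>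
    (\<forall>t. f (cis t) = cis (F t))"

lemma cis_in_circle: "cis x \<in> circle"
  by simp

lemma cis_eq_shift:
  assumes "cis a = cis b" obtains k :: int where "a = b + of_int k * (2 * pi)"
proof -
  obtain k where k: "b \<le> a + of_int k * (2 * pi)" "a + of_int k * (2 * pi) < b + 2 * pi"
    using representative[of "2 * pi" b a] by auto
  have "\<not> b < a + of_int k * (2 * pi)"
    using cis_distinct[of b "a + of_int k * (2 * pi)"] k cis_shift[of a k] assms by metis
  then have "a = b + of_int (- k) * (2 * pi)" using k by simp
  then show ?thesis using that by blast
qed

lemma cis_inj_window:
  assumes "cis a = cis b" "x \<le> a" "a < x + 2 * pi" "x \<le> b" "b < x + 2 * pi"
  shows "a = b"
  using cis_distinct[of a b] cis_distinct[of b a] assms by (cases a b rule: linorder_cases) auto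

lemma homeo_plus_Bij: "f \<in> homeo_plus \<Longrightarrow> f \<in> Bij circle"
  by (simp add: homeo_plus_def)

lemma homeo_plus_inj: "f \<in> homeo_plus \<Longrightarrow> inj_on f circle"
  by (simp add: homeo_plus_def Bij_def bij_betw_def)

text \<open>The lift advances by \<open>k\<close> full turns per period. Monotonicity gives a
  positive \<open>k\<close>; with two or more turns, the intermediate value theorem finds two points
  of one period with the same image.\<close>

lemma homeo_plus_lift:
  assumes f: "f \<in> homeo_plus"
  obtains F where "lifts F f"
proof -
  obtain F where F: "continuous_on UNIV F" "strict_mono F" "\<And>t. f (cis t) = cis (F t)"
    using f by (auto simp: homeo_plus_def orientation_preserving_def)
  have period: "F (t + 2 * pi) = F t + 2 * pi" for t
  proof -
    have "cis (t + 2 * pi) = cis t" using cis_shift[of t 1] by simp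
    then have "cis (F (t + 2 * pi)) = cis (F t)" using F(3) by metis
    then obtain k where k: "F (t + 2 * pi) = F t + of_int k * (2 * pi)" using cis_eq_shift by blast
    have "F t < F (t + 2 * pi)" using F(2) by (simp add: strict_mono_less)
    then have "0 < of_int k * (2 * pi)" using k by simp
    then have "k \<ge> 1" by (simp add: zero_less_mult_iff)
    moreover have "\<not> k \<ge> 2"
    proof
      assume "k \<ge> 2"
      then have "2 * (2 * pi) \<le> of_int k * (2 * pi)" by (intro mult_right_mono) auto
      then have lt: "F t + 2 * pi < F (t + 2 * pi)" using k pi_gt_zero by linarith
      obtain s where s: "t \<le> s" "s \<le> t + 2 * pi" "F s = F t + 2 * pi"
        using IVT'[of F t "F t + 2 * pi" "t + 2 * pi"] lt F(1) continuous_on_subset by force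
      have "t < s" "s < t + 2 * pi" using s lt by (auto simp: less_le)
      moreover have "f (cis s) = f (cis t)" using F(3) s(3) cis_shift[of "F t" 1] by simp
      ultimately show False
        using inj_onD[OF homeo_plus_inj[OF f]] cis_distinct[of t s] cis_in_circle by metis
    qed
    ultimately have "k = 1" by simp
    then show ?thesis using k by simp
  qed
  have "surj F"
  proof -
    have "\<exists>x. y = F x" for y
    proof -
      have "f ` circle = circle" using homeo_plus_Bij[OF f] by (simp add: Bij_def bij_betw_def)
      then obtain w where w: "w \<in> circle" "cis y = f w" using cis_in_circle[of y] by (metis imageE)
      obtain s where "w = cis s" using circle_angle[OF w(1), of 0] by blast
      then have "cis y = cis (F s)" using w F(3) by simp
      then obtain k where "y = F s + of_int k * (2 * pi)" using cis_eq_shift by blast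
      then show ?thesis using translation_of_int[of F "2 * pi" s k] period by metis
    qed
    then show ?thesis by blast
  qed
  then show ?thesis using that F period by (auto simp: lifts_def)
qed

lemma lift_fixing:
  assumes f: "f \<in> homeo_plus" and p: "f (cis p) = cis p"
  obtains F where "lifts F f" "F p = p"
proof -
  obtain F where F: "lifts F f" using homeo_plus_lift[OF f] .
  then have "cis (F p) = cis p" using p by (simp add: lifts_def)
  then obtain k where k: "F p = p + of_int k * (2 * pi)" using cis_eq_shift by blast
  define F' where "F' = (\<lambda>x. F x + of_int (- k) * (2 * pi))"
  have "surj F'"
  proof (rule surjI)
    show "F' (inv_map F (w - of_int (- k) * (2 * pi))) = w" for w
      using F surj_f_inv_f[of F] by (simp add: F'_def lifts_def)
  qed
  moreover have "strict_mono F'" using F by (auto simp: F'_def lifts_def strict_mono_def)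
  moreover have "f (cis t) = cis (F' t)" for t
    using F cis_shift[of "F t" "- k"] by (simp add: F'_def lifts_def)
  ultimately have "lifts F' f" using F by (auto simp: lifts_def F'_def)
  moreover have "F' p = p" using k by (simp add: F'_def)
  ultimately show ?thesis using that by blast
qed

text \<open>A lift fixing \<open>p\<close> maps the period starting at \<open>p\<close> into itself,
  and \<open>cis\<close> is injective there, so a fixed circle point cannot be translated by a full
  turn.\<close>

lemma lift_fixes_iff:
  assumes F: "lifts F f" and p: "F p = p" and x: "p \<le> x" "x < p + 2 * pi"
  shows "F x = x \<longleftrightarrow> f (cis x) = cis x"
proof
  assume "f (cis x) = cis x"
  then have "cis (F x) = cis x" using F by (simp add: lifts_def)
  moreover have "p \<le> F x" "F x < p + 2 * pi"
  proof -
    have m: "strict_mono F" "F (p + 2 * pi) = p + 2 * pi" using F p by (auto simp: lifts_def)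
    show "p \<le> F x" using strict_mono_less_eq[OF m(1), of p x] p x by simp
    show "F x < p + 2 * pi" using strict_mono_less[OF m(1), of x "p + 2 * pi"] m(2) x by simp
  qed
  ultimately show "F x = x" using cis_inj_window x by blast
qed (use F in \<open>simp add: lifts_def\<close>)

lemma Fix_lift:
  assumes F: "lifts F f" and p: "F p = p"
  shows "Fix f = cis ` {x. F x = x}"
proof
  show "Fix f \<subseteq> cis ` {x. F x = x}"
  proof
    fix z assume z: "z \<in> Fix f"
    then obtain x where x: "p \<le> x" "x < p + 2 * pi" "z = cis x" using circle_angle[of z p] by (auto simp: Fix_def)
    then have "F x = x" using lift_fixes_iff[OF F p x(1,2)] z by (simp add: Fix_def)
    then show "z \<in> cis ` {x. F x = x}" using x by blast
  qed
  show "cis ` {x. F x = x} \<subseteq> Fix f" using F by (auto simp: Fix_def lifts_def)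
qed

lemma lift_countable:
  assumes F: "lifts F f" and count: "countable (Fix f)"
  shows "countable {x. F x = x}"
proof (rule countable_subset)
  have "countable {x. cis x = z}" for z
  proof (cases "\<exists>x0. z = cis x0")
    case True
    then obtain x0 where "z = cis x0" by blast
    then have "{x. cis x = z} \<subseteq> range (\<lambda>k::int. x0 + of_int k * (2 * pi))"
      using cis_eq_shift by blast
    then show ?thesis by (rule countable_subset) simp
  next
    case False
    then have "{x. cis x = z} = {}" by blast
    then show ?thesis by (metis countable_empty)
  qed
  then show "countable (\<Union>z\<in>Fix f. {x. cis x = z})" using count by (intro countable_UN) auto
  show "{x. F x = x} \<subseteq> (\<Union>z\<in>Fix f. {x. cis x = z})" using F by (auto simp: Fix_def lifts_def)
qed

lemma lift_id:
  assumes F: "lifts F f" and p: "F p = p" and f: "\<And>t. f (cis t) = cis t"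
  shows "F = id"
proof
  fix x
  obtain k where k: "p \<le> x + of_int k * (2 * pi)" "x + of_int k * (2 * pi) < p + 2 * pi"
    using representative[of "2 * pi" p x] by auto
  have "F (x + of_int k * (2 * pi)) = x + of_int k * (2 * pi)"
    using lift_fixes_iff[OF F p k] f by simp
  moreover have "F (x + of_int k * (2 * pi)) = F x + of_int k * (2 * pi)"
    using translation_of_int[of F "2 * pi" x k] F by (simp add: lifts_def)
  ultimately show "F x = id x" by simp
qed

lemma lifts_leaf_iff:
  assumes F: "lifts F f" and f: "f \<in> G" "G \<subseteq> homeo_plus" and invariant: "invariant G \<Lambda>" and \<Lambda>: "lamination \<Lambda>"
  shows "(s, t) \<in> lift \<Lambda> \<longleftrightarrow> (F s, F t) \<in> lift \<Lambda>"
proof -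
  have sm: "strict_mono F" and per: "F (s + 2 * pi) = F s + 2 * pi" and cisF: "\<And>t. f (cis t) = cis (F t)"
    using F by (auto simp: lifts_def)
  have "F s < F t \<longleftrightarrow> s < t" "F t < F s + 2 * pi \<longleftrightarrow> t < s + 2 * pi"
    using strict_mono_less[OF sm, of s t] strict_mono_less[OF sm, of t "s + 2 * pi"] per by auto
  moreover have "{cis s, cis t} \<in> \<Lambda> \<longleftrightarrow> {cis (F s), cis (F t)} \<in> \<Lambda>"
  proof -
    have im: "f ` {cis s, cis t} = {cis (F s), cis (F t)}" by (simp add: cisF)
    have \<Lambda>_im: "(\<lambda>l. f ` l) ` \<Lambda> = \<Lambda>" using invariant f by (simp add: invariant_def)
    have inj: "inj_on f circle" using homeo_plus_inj f by blast
    show ?thesis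
    proof
      assume "{cis s, cis t} \<in> \<Lambda>"
      then show "{cis (F s), cis (F t)} \<in> \<Lambda>" using \<Lambda>_im im by (metis imageI)
    next
      assume "{cis (F s), cis (F t)} \<in> \<Lambda>"
      then obtain l where l: "l \<in> \<Lambda>" "f ` l = f ` {cis s, cis t}" using \<Lambda>_im im by (metis imageE)
      have "l \<subseteq> circle" using l(1) \<Lambda> by (auto simp: lamination_def pairs_def)
      then have "l = {cis s, cis t}" using inj_on_image_eq_iff[OF inj, of l "{cis s, cis t}"] l(2) by simp
      then show "{cis s, cis t} \<in> \<Lambda>" using l by simp
    qed
  qed
  ultimately show ?thesis by (auto simp: lift_def)
qed

section \<open>Groups of circle homeomorphisms\<close>

lemma mult_apply: "f \<in> Bij S \<Longrightarrow> g \<in> Bij S \<Longrightarrow> x \<in> S \<Longrightarrow> (f \<otimes>\<^bsub>BijGroup S\<^esub> g) x = f (g x)"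
  by (simp add: BijGroup_def compose_eq)

lemma pow_Bij: "f \<in> Bij S \<Longrightarrow> f [^]\<^bsub>BijGroup S\<^esub> (n::nat) \<in> Bij S"
  using monoid.nat_pow_closed[OF group.is_monoid[OF group_BijGroup], of f S n] by (simp add: BijGroup_def)

lemma int_pow_Bij: "f \<in> Bij S \<Longrightarrow> f [^]\<^bsub>BijGroup S\<^esub> (k::int) \<in> Bij S"
  using group.int_pow_closed[OF group_BijGroup, of f S k] by (simp add: BijGroup_def)

lemma int_pow_add_apply:
  assumes "f \<in> Bij S" "x \<in> S"
  shows "(f [^]\<^bsub>BijGroup S\<^esub> (i + j :: int)) x
    = (f [^]\<^bsub>BijGroup S\<^esub> i) ((f [^]\<^bsub>BijGroup S\<^esub> j) x)"
proof -
  have "f \<in> carrier (BijGroup S)" using assms(1) by (simp add: BijGroup_def)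
  then show ?thesis
    using group.int_pow_mult[OF group_BijGroup, of f S i j]
      mult_apply[OF int_pow_Bij int_pow_Bij, OF assms(1,1,2)] by simp
qed

lemma int_pow_fixed:
  assumes f: "f \<in> Bij S" "x \<in> S" "f x = x"
  shows "(f [^]\<^bsub>BijGroup S\<^esub> (k::int)) x = x"
proof -
  have one: "(f [^]\<^bsub>BijGroup S\<^esub> (0::int)) x = x" using f(2) by (simp add: BijGroup_def)
  have n: "(f [^]\<^bsub>BijGroup S\<^esub> int n) x = x" for n
  proof (induction n)
    case (Suc n)
    have "f [^]\<^bsub>BijGroup S\<^esub> (1::int) = f"
      using group.int_pow_1[OF group_BijGroup, of f S] f(1) by (simp add: BijGroup_def)
    then show ?case using int_pow_add_apply[OF f(1,2), of "int n" 1] Suc f(3) by (simp add: add.commute)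
  qed (use one in simp)
  show ?thesis
  proof (cases "k \<ge> 0")
    case True then show ?thesis using n[of "nat k"] by simp
  next
    case False
    then show ?thesis using int_pow_add_apply[OF f(1,2), of k "int (nat (- k))"] n[of "nat (- k)"] one by simp
  qed
qed

text \<open>Two natural powers agree at \<open>p\<close> by the pigeonhole principle, and applying
  the inverse of the smaller power gives a positive return time.\<close>

lemma Per_returns:
  assumes f: "f \<in> Bij circle" and p: "p \<in> Per f"
  obtains n :: nat where "n > 0" "(f [^]\<^bsub>BijGroup circle\<^esub> n) p = p"
proof -
  let ?o = "\<lambda>k::int. (f [^]\<^bsub>BijGroup circle\<^esub> k) p"
  have pc: "p \<in> circle" and fin: "finite (range ?o)"
    using p by (auto simp: Per_def full_SetCompr_eq)
  have "\<not> inj (\<lambda>n. ?o (int n))"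
    using fin finite_subset[of "range (\<lambda>n. ?o (int n))" "range ?o"] range_inj_infinite by blast
  then obtain i j where ij: "i < j" "?o (int i) = ?o (int j)"
    unfolding inj_def by (metis linorder_neqE_nat)
  have diff: "- int i + int j = int (j - i)" using ij by simp
  have "?o (- int i + int i) = ?o (- int i + int j)"
    unfolding int_pow_add_apply[OF f pc] ij(2) ..
  then have "?o 0 = ?o (int (j - i))" unfolding diff by (simp only: add.left_inverse)
  moreover have "?o 0 = p" using pc by (simp add: BijGroup_def)
  ultimately have "(f [^]\<^bsub>BijGroup circle\<^esub> (j - i)) p = p" unfolding int_pow_int by (rule trans[OF sym])
  then show ?thesis using that[of "j - i"] ij by simp
qed

lemma Fix_pow_subset_Per:
  assumes f: "f \<in> Bij circle" and n: "n > 0"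
  shows "Fix (f [^]\<^bsub>BijGroup circle\<^esub> (n::nat)) \<subseteq> Per f"
proof
  fix q assume q: "q \<in> Fix (f [^]\<^bsub>BijGroup circle\<^esub> n)"
  then have qc: "q \<in> circle" by (simp add: Fix_def)
  let ?G = "BijGroup circle"
  have carrier: "f \<in> carrier ?G" using f by (simp add: BijGroup_def)
  have "(f [^]\<^bsub>?G\<^esub> k) q \<in> (\<lambda>j. (f [^]\<^bsub>?G\<^esub> j) q) ` {0..<int n}" for k :: int
  proof -
    have "(f [^]\<^bsub>?G\<^esub> int n) q = q" using q by (simp add: Fix_def int_pow_int)
    from int_pow_fixed[OF int_pow_Bij[OF f] qc this]
    have fixed: "(f [^]\<^bsub>?G\<^esub> (int n * (k div int n))) q = q"
      using group.int_pow_pow[OF group_BijGroup carrier] by simp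
    have "(f [^]\<^bsub>?G\<^esub> (k mod int n + int n * (k div int n))) q = (f [^]\<^bsub>?G\<^esub> (k mod int n)) q"
      by (simp only: int_pow_add_apply[OF f qc] fixed)
    then show ?thesis using n by (intro image_eqI[of _ _ "k mod int n"]) auto
  qed
  then have "{(f [^]\<^bsub>?G\<^esub> k) q | k::int. True} \<subseteq> (\<lambda>j. (f [^]\<^bsub>?G\<^esub> j) q) ` {0..<int n}" by blast
  then have "finite {(f [^]\<^bsub>?G\<^esub> k) q | k::int. True}" by (rule finite_subset) simp
  then show "q \<in> Per f" using qc by (simp add: Per_def)
qed

section \<open>Periodic points through lifts\<close>

lemma pow_lift:
  assumes f: "f \<in> Bij circle" and F: "\<And>t. f (cis t) = cis (F t)"
  shows "(f [^]\<^bsub>BijGroup circle\<^esub> (n::nat)) (cis t) = cis ((F ^^ n) t)"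
proof (induction n arbitrary: t)
  case 0 then show ?case by (simp add: BijGroup_def)
next
  case (Suc n)
  then show ?case using mult_apply[OF pow_Bij[OF f, of n] f cis_in_circle] F by (simp add: funpow_swap1)
qed

lemma iterate_fixed:
  fixes F :: "real \<Rightarrow> real"
  assumes F: "strict_mono F" and n: "n > 0" "(F ^^ n) x = x"
  shows "F x = x"
proof (rule ccontr)
  assume "F x \<noteq> x"
  then consider "x < F x" | "F x < x" by linarith
  then show False
  proof cases
    case 1
    have "x < (F ^^ Suc m) x" for m
    proof (induction m)
      case (Suc m)
      then have "F x < F ((F ^^ Suc m) x)" using F by (simp only: strict_mono_less)
      then show ?case using 1 by simp
    qed (use 1 in simp)
    then show False using n by (metis gr0_implies_Suc less_irrefl)
  next
    case 2
    have "(F ^^ Suc m) x < x" for m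
    proof (induction m)
      case (Suc m)
      then have "F ((F ^^ Suc m) x) < F x" using F by (simp only: strict_mono_less)
      then show ?case using 2 by simp
    qed (use 2 in simp)
    then show False using n by (metis gr0_implies_Suc less_irrefl)
  qed
qed

text \<open>Periodic points of an increasing lift with a fixed point are fixed.\<close>

lemma Per_eq_Fix_pow:
  assumes g: "g \<in> Bij circle" and n: "n > 0" and F: "lifts F (g [^]\<^bsub>BijGroup circle\<^esub> (n::nat))" "F p = p"
  shows "Per g = Fix (g [^]\<^bsub>BijGroup circle\<^esub> n)"
proof
  let ?G = "BijGroup circle"
  let ?f = "g [^]\<^bsub>?G\<^esub> n"
  have carrier: "g \<in> carrier ?G" using g by (simp add: BijGroup_def)
  show "Per g \<subseteq> Fix ?f"
  proof
    fix q assume q: "q \<in> Per g"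
    then have qc: "q \<in> circle" by (simp add: Per_def)
    obtain m where m: "m > 0" "(g [^]\<^bsub>?G\<^esub> (m::nat)) q = q" using Per_returns[OF g q] .
    \<comment> \<open>A power fixing \<open>q\<close> is raised to the exponent \<open>n\<close>, so
      that after exchanging exponents it becomes a power of \<open>?f\<close>, whose lift
      \<open>F\<close> has a fixed point.\<close>
    have "((g [^]\<^bsub>?G\<^esub> m) [^]\<^bsub>?G\<^esub> n) q = q"
      using int_pow_fixed[OF pow_Bij[OF g] qc m(2), of "int n"] by (simp add: int_pow_int)
    then have fm: "(?f [^]\<^bsub>?G\<^esub> m) q = q"
      using monoid.nat_pow_pow[OF group.is_monoid[OF group_BijGroup] carrier] by (simp add: mult.commute)
    obtain x where x: "p \<le> x" "x < p + 2 * pi" "q = cis x" using circle_angle[OF qc] .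
    have sm: "strict_mono F" and F2: "F (p + 2 * pi) = p + 2 * pi" and cisF: "\<And>t. ?f (cis t) = cis (F t)"
      using F by (auto simp: lifts_def)
    have "cis ((F ^^ m) x) = cis x" using pow_lift[OF pow_Bij[OF g] cisF] fm x(3) by metis
    moreover have "p \<le> (F ^^ m) x \<and> (F ^^ m) x < p + 2 * pi"
    proof -
      have "(F ^^ m) p = p" "(F ^^ m) (p + 2 * pi) = p + 2 * pi"
        using F(2) F2 by (induction m) auto
      then show ?thesis
        using x strict_mono_less[OF iterate_strict_mono[OF sm], of m x "p + 2 * pi"]
          strict_mono_less_eq[OF iterate_strict_mono[OF sm], of m p x] by simp
    qed
    ultimately have "(F ^^ m) x = x" using cis_inj_window x by blast
    then have "F x = x" using iterate_fixed[OF sm m(1)] by blast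
    then show "q \<in> Fix ?f" using x(3) cisF by (simp add: Fix_def)
  qed
  show "Fix ?f \<subseteq> Per g" using Fix_pow_subset_Per[OF g n] .
qed

text \<open>Requiring \<open>F p = p\<close> selects one lift for each stabilizer element, so
  composites and inverses of selected lifts are selected lifts again.\<close>

lemma point_stabilizer_lifts:
  assumes G: "subgroup G (BijGroup circle)" "G \<subseteq> homeo_plus"
    and \<Lambda>1: "lamination \<Lambda>1" "very_full \<Lambda>1" "loose \<Lambda>1" "invariant G \<Lambda>1"
    and \<Lambda>2: "lamination \<Lambda>2" "very_full \<Lambda>2" "loose \<Lambda>2" "invariant G \<Lambda>2"
    and disjoint: "distinct_endpoints \<Lambda>1 \<Lambda>2"
    and count: "\<And>g. g \<in> G \<Longrightarrow> g \<noteq> \<one>\<^bsub>BijGroup circle\<^esub> \<Longrightarrow> countable (Fix g)"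
  shows "point_stabilizer (2 * pi) (lift \<Lambda>1) (lift \<Lambda>2) {F. \<exists>f\<in>G. lifts F f \<and> F p = p} p"
proof -
  interpret A: lifted_lamination "2 * pi" "lift \<Lambda>1" by (rule lifted_lamination_lift[OF \<Lambda>1(1-3)])
  interpret B: lifted_lamination "2 * pi" "lift \<Lambda>2" by (rule lifted_lamination_lift[OF \<Lambda>2(1-3)])
  let ?S = "{F. \<exists>f\<in>G. lifts F f \<and> F p = p}"
  have Bij: "f \<in> Bij circle" if "f \<in> G" for f using homeo_plus_Bij G(2) that by blast
  show ?thesis
  proof
    show False if "(x, y) \<in> lift \<Lambda>1" "(x, z) \<in> lift \<Lambda>2" for x y z
    proof -
      have "cis x \<in> \<Union>\<Lambda>1" "cis x \<in> \<Union>\<Lambda>2" using that by (auto simp: lift_def)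
      then show False using disjoint by (auto simp: distinct_endpoints_def)
    qed
    show "pair_aut (2 * pi) (lift \<Lambda>1) (lift \<Lambda>2) F" if S: "F \<in> ?S" for F
    proof -
      obtain f where f: "f \<in> G" "lifts F f" using S by blast
      show ?thesis
        unfolding pair_aut_def
        using lifts_leaf_iff[OF f(2,1) G(2) \<Lambda>1(4,1)] lifts_leaf_iff[OF f(2,1) G(2) \<Lambda>2(4,1)] f(2)
        by (auto simp: lifts_def)
    qed
    show "F p = p" if "F \<in> ?S" for F using that by blast
    show "F \<circ> K \<in> ?S" if S: "F \<in> ?S" "K \<in> ?S" for F K
    proof -
      obtain f where f: "f \<in> G" "lifts F f" "F p = p" using S(1) by blast
      obtain k where k: "k \<in> G" "lifts K k" "K p = p" using S(2) by blast
      have "f \<otimes>\<^bsub>BijGroup circle\<^esub> k \<in> G" using subgroup.m_closed[OF G(1)] f k by blast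
      moreover have "lifts (F \<circ> K) (f \<otimes>\<^bsub>BijGroup circle\<^esub> k)"
        unfolding lifts_def
      proof (intro conjI allI)
        show "strict_mono (F \<circ> K)" using f(2) k(2) by (auto simp: lifts_def strict_mono_def)
        show "surj (F \<circ> K)" by (rule comp_surj) (use f(2) k(2) in \<open>auto simp: lifts_def\<close>)
        show "(F \<circ> K) (x + 2 * pi) = (F \<circ> K) x + 2 * pi" for x using f(2) k(2) by (simp add: lifts_def)
        show "(f \<otimes>\<^bsub>BijGroup circle\<^esub> k) (cis t) = cis ((F \<circ> K) t)" for t
          using mult_apply[OF Bij[OF f(1)] Bij[OF k(1)] cis_in_circle] f(2) k(2) by (simp add: lifts_def)
      qed
      ultimately show ?thesis using f(3) k(3) by auto
    qed
    show "inv_map F \<in> ?S" if S: "F \<in> ?S" for F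
    proof -
      obtain f where f: "f \<in> G" "lifts F f" "F p = p" using S by blast
      have F: "strict_mono F" "surj F" and cisF: "\<And>t. f (cis t) = cis (F t)" and per: "\<And>x. F (x + 2 * pi) = F x + 2 * pi"
        using f(2) by (auto simp: lifts_def)
      have iF: "inv_map F (F x) = x" "F (inv_map F x) = x" for x
        using F strict_mono_imp_inj_on[of F UNIV] by (simp_all add: surj_f_inv_f inv_f_f)
      have inv_eq: "inv\<^bsub>BijGroup circle\<^esub> f = (\<lambda>x\<in>circle. inv_into circle f x)"
        using inv_BijGroup[OF Bij[OF f(1)]] .
      have "inv\<^bsub>BijGroup circle\<^esub> f \<in> G" using subgroup.m_inv_closed[OF G(1) f(1)] .
      moreover have "lifts (inv_map F) (inv\<^bsub>BijGroup circle\<^esub> f)"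
        unfolding lifts_def
      proof (intro conjI allI)
        show "strict_mono (inv_map F)" "surj (inv_map F)" using strict_mono_inv_real[OF F] by auto
        show "inv_map F (x + 2 * pi) = inv_map F x + 2 * pi" for x
          using iF(1)[of "inv_map F x + 2 * pi"] per[of "inv_map F x"] iF(2)[of x] by simp
        show "(inv\<^bsub>BijGroup circle\<^esub> f) (cis t) = cis (inv_map F t)" for t
        proof -
          have "f (cis (inv_map F t)) = cis t" using cisF iF(2) by simp
          then have "inv_into circle f (cis t) = cis (inv_map F t)"
            using inv_into_f_f[OF homeo_plus_inj cis_in_circle, of f "inv_map F t"] f(1) G(2) by auto
          then show ?thesis by (simp add: inv_eq)
        qed
      qed
      moreover have "inv_map F p = p" using iF(1)[of p] f(3) by simp
      ultimately show ?thesis by blast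
    qed
    show "countable {x. F x = x}" if S: "F \<in> ?S" "F \<noteq> id" for F
    proof -
      obtain f where f: "f \<in> G" "lifts F f" "F p = p" using S by blast
      have "f \<noteq> \<one>\<^bsub>BijGroup circle\<^esub>"
        using lift_id[OF f(2,3)] S(2) by (auto simp: BijGroup_def)
      then show ?thesis using lift_countable[OF f(2) count[OF f(1)]] by blast
    qed
  qed
qed

lemma subgroup_nat_pow:
  assumes "subgroup G M" "g \<in> G" shows "g [^]\<^bsub>M\<^esub> (n::nat) \<in> G"
  by (induction n) (use assms in \<open>auto simp: subgroup.one_closed subgroup.m_closed\<close>)

theorem theorem2:
  fixes G :: "(complex \<Rightarrow> complex) set" and g h :: "complex \<Rightarrow> complex"
  assumes "pseudo_fibered_group G" and "torsion_free G"
    and "g \<in> G" and "g \<noteq> \<one>\<^bsub>BijGroup circle\<^esub>"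
    and "h \<in> G" and "h \<noteq> \<one>\<^bsub>BijGroup circle\<^esub>"
  shows "Per g = Per h \<or> Per g \<inter> Per h = {}"
proof (rule disjCI)
  assume "Per g \<inter> Per h \<noteq> {}"
  then obtain z where z: "z \<in> Per g" "z \<in> Per h" by blast
  have G: "subgroup G (BijGroup circle)" "G \<subseteq> homeo_plus"
    using assms(1) by (auto simp: pseudo_fibered_group_def laminar_group_def)
  obtain \<Lambda>1 \<Lambda>2 where \<Lambda>: "lamination \<Lambda>1" "lamination \<Lambda>2" "very_full \<Lambda>1" "very_full \<Lambda>2" "loose \<Lambda>1" "loose \<Lambda>2"
      "distinct_endpoints \<Lambda>1 \<Lambda>2" "invariant G \<Lambda>1" "invariant G \<Lambda>2"
    using assms(1) by (auto simp: pseudo_fibered_group_def)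
  have count: "countable (Fix f)" if "f \<in> G" "f \<noteq> \<one>\<^bsub>BijGroup circle\<^esub>" for f
    using assms(1) that by (auto simp: pseudo_fibered_group_def)
  obtain p where p: "z = cis p" using z(1) circle_angle[of z 0] by (auto simp: Per_def)
  \<comment> \<open>The common periodic point is the base point: suitable powers of both elements
    fix it and lie in one stabilizer.\<close>
  interpret point_stabilizer "2 * pi" "lift \<Lambda>1" "lift \<Lambda>2" "{F. \<exists>f\<in>G. lifts F f \<and> F p = p}" p
    by (rule point_stabilizer_lifts[OF G \<Lambda>(1,3,5,8) \<Lambda>(2,4,6,9,7) count])
  have lift_power: "\<exists>F. F \<noteq> id \<and> F \<in> {F. \<exists>f\<in>G. lifts F f \<and> F p = p} \<and> Per f = cis ` {x. F x = x}"
    if f: "f \<in> G" "f \<noteq> \<one>\<^bsub>BijGroup circle\<^esub>" "z \<in> Per f" for f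
  proof -
    have fB: "f \<in> Bij circle" using f(1) G(2) homeo_plus_Bij by blast
    obtain n where n: "n > 0" "(f [^]\<^bsub>BijGroup circle\<^esub> (n::nat)) z = z" using Per_returns[OF fB f(3)] .
    let ?f = "f [^]\<^bsub>BijGroup circle\<^esub> n"
    have fG: "?f \<in> G" using subgroup_nat_pow[OF G(1) f(1)] .
    then obtain F where F: "lifts F ?f" "F p = p" using lift_fixing[of ?f p] G(2) n(2) p by blast
    \<comment> \<open>A trivial lift would make a positive power of \<open>f\<close> trivial,
      against torsion-freeness.\<close>
    have "F \<noteq> id"
    proof
      assume "F = id"
      have "?f = \<one>\<^bsub>BijGroup circle\<^esub>"
      proof (rule extensionalityI)
        show "?f \<in> extensional circle" using pow_Bij[OF fB] Bij_imp_extensional by blast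
        show "\<one>\<^bsub>BijGroup circle\<^esub> \<in> extensional circle" by (simp add: BijGroup_def)
        fix w assume w: "w \<in> circle"
        then obtain x where "w = cis x" using circle_angle[of w 0] by blast
        then show "?f w = \<one>\<^bsub>BijGroup circle\<^esub> w"
          using F(1) w \<open>F = id\<close> by (simp add: lifts_def BijGroup_def)
      qed
      then show False using assms(2) f n(1) by (auto simp: torsion_free_def)
    qed
    moreover have "Per f = cis ` {x. F x = x}"
      using Per_eq_Fix_pow[OF fB n(1) F] Fix_lift[OF F] by simp
    ultimately show ?thesis using F fG by blast
  qed
  obtain F where F: "F \<noteq> id" "F \<in> {F. \<exists>f\<in>G. lifts F f \<and> F p = p}" "Per g = cis ` {x. F x = x}"
    using lift_power[OF assms(3,4) z(1)] by blast
  obtain K where K: "K \<noteq> id" "K \<in> {F. \<exists>f\<in>G. lifts F f \<and> F p = p}" "Per h = cis ` {x. K x = x}"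
    using lift_power[OF assms(5,6) z(2)] by blast
  show "Per g = Per h" using fixed_points_eq[OF F(2,1) K(2,1)] F(3) K(3) by simp
qed

end
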